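(* Let $T:I\to I$ be a proper one-dimensional Iwasawa continued fraction map with transfer operator $H$, and let $k\in\mathbb N$ be large enough that $0<\rho:=2\gamma^{2k}<1$. Then there exists a constant $M_0$ such that for all $f\in BV(I)$, $$\mathrm{var}_I\,H^kf\le\rho\,\mathrm{var}_I f+M_0\|f\|_1,$$ and consequently, with $M=M_0+1-\rho$, $$\|H^kf\|_{BV}\le\rho\|f\|_{BV}+M\|f\|_1 .$$
   Context: Setting: $I=[a,b]$ is a compact nondegenerate interval. A (one-dimensional) Iwasawa continued fraction map is a map $T:I\to I$ for which $I$ admits a countable partition (up to common endpoints, and up to the point $0$ where the value of $T$ is irrelevant) into nondegenerate subintervals such that on each of them $T(x)=\iota(x)+\text{const}$, where $\iota$ is one fixed function among $1/x,\,-1/x,\,|1/x|,\,-|1/x|$; hence $|T'(x)|=1/x^2$. Let $\mathcal H$ be the set of inverse branches of $T$; for $h\in\mathcal H$, $I_h$ is the partition interval which is the range of $h$, and $TI_h$ is the domain of $h$. It is required that $TI_h=I$ for every $h$, except possibly for the leftmost and rightmost partition intervals, for which $TI_h$ must still be an interval sharing an endpoint with $I$. $T$ is proper if $\gamma:=\max\{|a|,|b|\}<1$. Transfer operator: for $f\in L^1(I)$ (complex-valued), $Hf(x)=\sum_{h\in\mathcal H}|h'(x)|\,f(h(x))\,\chi_{TI_h}(x)$. $BV(I)\subset L^1(I)$ is the Banach space of (classes of) complex functions of bounded variation; $\mathrm{var}_I f$ for a class $f$ means the infimum of the total variation over all functions a.e. equal to $f$, and $\|f\|_{BV}=\|f\|_1+\mathrm{var}_I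 f$. *)

theory Defs
  imports "HOL-Analysis.Analysis"
begin

definition inversions :: "(real \<Rightarrow> real) set" where
  "inversions = {\<lambda>x. 1 / x, \<lambda>x. - 1 / x, \<lambda>x. \<bar>1 / x\<bar>, \<lambda>x. - \<bar>1 / x\<bar>}"

text \<open>
  The branch on the partition interval \<open>J\<close> is \<open>x \<mapsto> \<iota> x + c J\<close>. Its image \<open>T I\<^sub>h\<close> is taken over the
  closed interval \<open>J\<close>, because at a common endpoint of two partition intervals \<open>T\<close> itself
  follows only one of the two branches.
\<close>

definition branch_image :: "(real \<Rightarrow> real) \<Rightarrow> (real set \<Rightarrow> real) \<Rightarrow> real set \<Rightarrow> real set" where
  "branch_image \<iota> c J = (\<lambda>x. \<iota> x + c J) ` J"

definition inverse_branch ::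
    "(real \<Rightarrow> real) \<Rightarrow> (real set \<Rightarrow> real) \<Rightarrow> real set \<Rightarrow> real \<Rightarrow> real" where
  "inverse_branch \<iota> c J = inv_into J (\<lambda>x. \<iota> x + c J)"

definition leftmost :: "real set set \<Rightarrow> real set \<Rightarrow> bool" where
  "leftmost P J \<longleftrightarrow> J \<in> P \<and> (\<forall>K\<in>P - {J}. \<forall>x\<in>J. \<forall>y\<in>K. x \<le> y)"

definition rightmost :: "real set set \<Rightarrow> real set \<Rightarrow> bool" where
  "rightmost P J \<longleftrightarrow> J \<in> P \<and> (\<forall>K\<in>P - {J}. \<forall>x\<in>J. \<forall>y\<in>K. y \<le> x)"

text \<open>
  \<open>T\<close> is an Iwasawa continued fraction map of \<open>{a..b}\<close>, witnessed by the function \<open>\<iota>\<close>, the set \<open>P\<close>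
  of (closed, non-overlapping) partition intervals and the additive constants \<open>c\<close>.
  At a common endpoint \<open>T\<close> may follow either adjacent branch, and \<open>T 0\<close> is arbitrary.
  When \<open>0\<close> lies in \<open>{a..b}\<close> it belongs to no member of \<open>P\<close>, since \<open>T\<close> is bounded.
\<close>

definition iwasawa_map ::
    "real \<Rightarrow> real \<Rightarrow> (real \<Rightarrow> real) \<Rightarrow> (real \<Rightarrow> real) \<Rightarrow> real set set \<Rightarrow> (real set \<Rightarrow> real) \<Rightarrow> bool" where
  "iwasawa_map a b T \<iota> P c \<longleftrightarrow>
     a < b \<and> T \<in> {a..b} \<rightarrow> {a..b} \<and> \<iota> \<in> inversions \<and>
     countable P \<and>
     (\<forall>J\<in>P. \<exists>l r. l < r \<and> J = {l..r} \<and> J \<subseteq> {a..b}) \<and>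
     (\<forall>J\<in>P. \<forall>K\<in>P. J \<noteq> K \<longrightarrow> interior J \<inter> interior K = {}) \<and>
     (\<forall>x\<in>{a..b} - {0}. \<exists>J\<in>P. x \<in> J \<and> T x = \<iota> x + c J) \<and>
     (\<forall>J\<in>P. \<forall>x\<in>interior J - {0}. T x = \<iota> x + c J) \<and>
     (\<forall>J\<in>P. branch_image \<iota> c J = {a..b} \<or>
        (leftmost P J \<or> rightmost P J) \<and>
        (\<exists>d\<in>{a..b}. branch_image \<iota> c J = {a..d} \<or> branch_image \<iota> c J = {d..b}))"

text \<open>
  The inverse branches \<open>h\<close> are indexed by their ranges \<open>J \<in> P\<close>. The derivative is taken within
  the domain of \<open>h\<close>, hence is one-sided at its endpoints. The series converges absolutely
  almost everywhere for integrable \<open>f\<close>; elsewhere the sum is \<open>0\<close> by the convention of \<open>infsum\<close>.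
\<close>

definition transfer ::
    "(real \<Rightarrow> real) \<Rightarrow> real set set \<Rightarrow> (real set \<Rightarrow> real) \<Rightarrow> (real \<Rightarrow> complex) \<Rightarrow> real \<Rightarrow> complex" where
  "transfer \<iota> P c f x =
     (\<Sum>\<^sub>\<infinity>J\<in>P.
        let h = inverse_branch \<iota> c J; D = branch_image \<iota> c J
        in of_real \<bar>vector_derivative h (at x within D)\<bar> * f (h x) * indicator D x)"

definition total_variation :: "real \<Rightarrow> real \<Rightarrow> (real \<Rightarrow> complex) \<Rightarrow> ennreal" where
  "total_variation a b g =
     (SUP xs\<in>{xs. sorted xs \<and> set xs \<subseteq> {a..b}}.
        \<Sum>i<length xs - 1. ennreal (cmod (g (xs ! Suc i) - g (xs ! i))))"

text \<open>
  Elements of \<open>L\<^sup>1\<close> and \<open>BV\<close> are represented by functions on the reals, of which only the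
  almost-everywhere class on \<open>{a..b}\<close> matters.
\<close>

definition ess_var :: "real \<Rightarrow> real \<Rightarrow> (real \<Rightarrow> complex) \<Rightarrow> ennreal" where
  "ess_var a b f =
     (INF g\<in>{g. AE x in lebesgue_on {a..b}. g x = f x}. total_variation a b g)"

definition L1_norm :: "real \<Rightarrow> real \<Rightarrow> (real \<Rightarrow> complex) \<Rightarrow> ennreal" where
  "L1_norm a b f = (\<integral>\<^sup>+x. ennreal (cmod (f x)) \<partial>lebesgue_on {a..b})"

definition BV :: "real \<Rightarrow> real \<Rightarrow> (real \<Rightarrow> complex) set" where
  "BV a b = {f. integrable (lebesgue_on {a..b}) f \<and> ess_var a b f < \<infinity>}"

definition BV_norm :: "real \<Rightarrow> real \<Rightarrow> (real \<Rightarrow> complex) \<Rightarrow> ennreal" where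
  "BV_norm a b f = L1_norm a b f + ess_var a b f"

end

theory Submission
  imports Defs
begin

text \<open>
  Every inverse branch \<open>h\<close> of an iterate \<open>T\<^sup>k\<close> is a composition of maps \<open>x \<mapsto> \<plusminus>1 / (x - c)\<close>, hence
  satisfies the exact identity \<open>\<bar>h x - h y\<bar> = \<bar>x - y\<bar> v x v y\<close> with \<open>v = \<bar>h'\<bar>\<^sup>1\<^sup>/\<^sup>2 \<le> \<gamma>\<^sup>k\<close>, and \<open>v\<close> has
  distortion bounded by \<open>\<bar>v x - v y\<bar> \<le> k \<bar>x - y\<bar> v x\<close>. On the range \<open>J\<close> of \<open>h\<close>, the variation of
  \<open>\<bar>h'\<bar> (f \<circ> h)\<close> inside the domain of \<open>h\<close> costs \<open>\<gamma>\<^sup>2\<^sup>k var\<^sub>J f\<close> plus, by the distortion bound, a multiple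
  of the integral of \<open>\<bar>f\<bar>\<close> over \<open>J\<close>. The jumps at both ends of the domain cost, by comparison with a
  point of \<open>J\<close> where \<open>\<bar>f\<bar>\<close> is at most its mean, a second \<open>\<gamma>\<^sup>2\<^sup>k var\<^sub>J f\<close> plus the mean times a bound for
  \<open>\<bar>h'\<bar>\<close>. The latter is comparable to the integral of \<open>\<bar>f\<bar>\<close> over \<open>J\<close>, because the branches of \<open>T\<^sup>k\<close> have
  only finitely many different images, whose lengths are therefore bounded from below. Summing over
  the non-overlapping ranges \<open>J\<close> gives the inequality.
\<close>

section \<open>Majorants of functions of bounded variation\<close>

text \<open>
  The variation of \<open>f\<close> is recorded by a monotone function \<open>\<phi>\<close>, because such functions, unlike
  total variations, can be pulled back along branches and summed pointwise.
\<close>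

definition majorizes :: "real \<Rightarrow> real \<Rightarrow> (real \<Rightarrow> real) \<Rightarrow> (real \<Rightarrow> complex) \<Rightarrow> bool" where
  "majorizes a b \<phi> f \<longleftrightarrow> (\<forall>x y. a \<le> x \<longrightarrow> x \<le> y \<longrightarrow> y \<le> b \<longrightarrow> cmod (f y - f x) \<le> \<phi> y - \<phi> x)"

lemma majorizesD:
  assumes "majorizes a b \<phi> f" "a \<le> x" "x \<le> y" "y \<le> b"
  shows "cmod (f y - f x) \<le> \<phi> y - \<phi> x" "\<phi> x \<le> \<phi> y"
proof -
  show *: "cmod (f y - f x) \<le> \<phi> y - \<phi> x"
    using assms by (auto simp: majorizes_def)
  show "\<phi> x \<le> \<phi> y"
    using order_trans[OF norm_ge_zero *] by simp
qed

section \<open>Majorants and total variation\<close>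

lemma total_variation_le_majorant:
  assumes m: "majorizes a b \<phi> f" and "a \<le> b"
  shows "total_variation a b f \<le> ennreal (\<phi> b - \<phi> a)"
  unfolding total_variation_def
proof (rule SUP_least)
  fix xs assume "xs \<in> {xs. sorted xs \<and> set xs \<subseteq> {a..b}}"
  then have xs: "sorted xs" "set xs \<subseteq> {a..b}" by auto
  define n where "n = length xs - 1"
  show "(\<Sum>i<length xs - 1. ennreal (cmod (f (xs ! Suc i) - f (xs ! i)))) \<le> ennreal (\<phi> b - \<phi> a)"
  proof (cases "xs = []")
    case False
    have mem: "xs ! i \<in> {a..b}" if "i \<le> n" for i
      using that xs(2) False by (metis One_nat_def Suc_pred length_greater_0_conv less_Suc_eq_le n_def nth_mem subsetD)
    have "(\<Sum>i<n. cmod (f (xs ! Suc i) - f (xs ! i))) \<le> (\<Sum>i<n. \<phi> (xs ! Suc i) - \<phi> (xs ! i))"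
    proof (rule sum_mono)
      fix i assume "i \<in> {..<n}"
      then have "xs ! i \<le> xs ! Suc i" "i \<le> n" "Suc i \<le> n"
        using xs(1) by (auto intro!: sorted_nth_mono simp: n_def)
      then show "cmod (f (xs ! Suc i) - f (xs ! i)) \<le> \<phi> (xs ! Suc i) - \<phi> (xs ! i)"
        using mem[of i] mem[of "Suc i"] by (intro majorizesD(1)[OF m]) auto
    qed
    also have "\<dots> = \<phi> (xs ! n) - \<phi> (xs ! 0)"
      by (rule sum_lessThan_telescope)
    also have "\<dots> \<le> \<phi> b - \<phi> a"
      using majorizesD(2)[OF m, of "xs ! n" b] majorizesD(2)[OF m, of a "xs ! 0"] mem[of n] mem[of 0] by auto
    finally show ?thesis
      unfolding n_def[symmetric] by (simp add: sum_ennreal ennreal_leI)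
  qed auto
qed

lemma total_variation_extend:
  assumes "a \<le> x" "x \<le> y"
  shows "total_variation a x f + ennreal (cmod (f y - f x)) \<le> total_variation a y f"
proof -
  let ?S = "\<lambda>xs. \<Sum>i<length xs - 1. ennreal (cmod (f (xs ! Suc i) - f (xs ! i)))"
  let ?X = "{xs. sorted xs \<and> set xs \<subseteq> {a..x}}"
  have "total_variation a x f + ennreal (cmod (f y - f x))
      = (SUP xs\<in>?X. ?S xs + ennreal (cmod (f y - f x)))"
    unfolding total_variation_def by (subst ennreal_SUP_add_left) (auto intro: exI[of _ "[]"])
  also have "\<dots> \<le> total_variation a y f"
  proof (rule SUP_least)
    fix xs assume xs: "xs \<in> ?X"
    \<comment> \<open>Appending \<open>x\<close> as well as \<open>y\<close> makes the last
      increment the wanted one even if \<open>xs\<close> does not end at \<open>x\<close>; the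
      increment leading to \<open>x\<close> is nonnegative and may be dropped.\<close>
    let ?ys = "xs @ [x, y]"
    have "?S xs + ennreal (cmod (f y - f x)) \<le> ?S ?ys"
    proof -
      have "?S xs = (\<Sum>i<length xs - 1. ennreal (cmod (f (?ys ! Suc i) - f (?ys ! i))))"
        by (intro sum.cong) (auto simp: nth_append)
      also have "\<dots> \<le> (\<Sum>i<length xs. ennreal (cmod (f (?ys ! Suc i) - f (?ys ! i))))"
        by (intro sum_mono2) auto
      finally show ?thesis
        by (simp add: nth_append add_mono)
    qed
    also have "\<dots> \<le> total_variation a y f"
      unfolding total_variation_def
      by (rule SUP_upper) (use xs assms in \<open>force simp: sorted_append\<close>)
    finally show "?S xs + ennreal (cmod (f y - f x)) \<le> total_variation a y f" .
  qed
  finally show ?thesis .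
qed

text \<open>The majorant is the variation over \<open>{a..x}\<close> as a function of
  \<open>x\<close>; finiteness on \<open>{a..b}\<close> permits the passage from extended to real
  values.\<close>

lemma total_variation_majorant:
  assumes "a \<le> b" and fin: "total_variation a b f < \<infinity>"
  obtains \<phi> where "majorizes a b \<phi> f" "ennreal (\<phi> b - \<phi> a) \<le> total_variation a b f"
proof
  let ?\<phi> = "\<lambda>x. enn2real (total_variation a x f)"
  have ext: "total_variation a x f + ennreal (cmod (f y - f x)) \<le> total_variation a y f"
    if "a \<le> x" "x \<le> y" for x y using total_variation_extend[OF that] .
  have le: "total_variation a x f \<le> total_variation a y f" if "a \<le> x" "x \<le> y" for x y
    using ext[OF that] by (metis add.right_neutral add_left_mono dual_order.trans zero_le)
  have fin': "total_variation a x f < \<infinity>" if "a \<le> x" "x \<le> b" for x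
    using le[OF that] fin by (rule le_less_trans)
  show "majorizes a b ?\<phi> f"
    unfolding majorizes_def
  proof (intro allI impI)
    fix x y assume xy: "a \<le> x" "x \<le> y" "y \<le> b"
    have "enn2real (total_variation a x f + ennreal (cmod (f y - f x))) \<le> ?\<phi> y"
      using ext[OF xy(1,2)] fin'[of y] xy by (intro enn2real_mono) auto
    moreover have "enn2real (total_variation a x f + ennreal (cmod (f y - f x))) = ?\<phi> x + cmod (f y - f x)"
      using fin'[of x] xy by (subst enn2real_plus) (auto simp: less_top)
    ultimately show "cmod (f y - f x) \<le> ?\<phi> y - ?\<phi> x" by simp
  qed
  have "ennreal (?\<phi> b - ?\<phi> a) \<le> ennreal (?\<phi> b)"
    by (intro ennreal_leI) simp
  also have "\<dots> = total_variation a b f"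
    using fin by (simp add: less_top)
  finally show "ennreal (?\<phi> b - ?\<phi> a) \<le> total_variation a b f" .
qed

section \<open>Boundedness, integrability and null sets\<close>

lemma majorizes_bounded:
  assumes "majorizes a b \<phi> f" "x \<in> {a..b}"
  shows "cmod (f x) \<le> cmod (f a) + (\<phi> b - \<phi> a)"
proof -
  have "cmod (f x) \<le> cmod (f a) + cmod (f x - f a)"
    by (rule norm_triangle_sub)
  also have "cmod (f x - f a) \<le> \<phi> x - \<phi> a"
    using assms(2) by (intro majorizesD(1)[OF assms(1)]) auto
  also have "\<phi> x \<le> \<phi> b"
    using assms(2) by (intro majorizesD(2)[OF assms(1)]) auto
  finally show ?thesis by simp
qed

text \<open>A real function \<open>u\<close> with increments bounded by those of
  \<open>\<phi>\<close> is the difference of the monotone functions \<open>\<phi> + u\<close> and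
  \<open>\<phi>\<close>, both integrable on a compact interval. This is applied to the real and
  imaginary parts of \<open>f\<close>.\<close>

lemma majorizes_integrable:
  assumes m: "majorizes a b \<phi> f"
  shows "integrable (lebesgue_on {a..b}) f"
proof -
  have aux: "integrable (lebesgue_on {a..b}) u"
    if u: "\<And>x y. a \<le> x \<Longrightarrow> x \<le> y \<Longrightarrow> y \<le> b \<Longrightarrow> \<bar>u y - u x\<bar> \<le> \<phi> y - \<phi> x" for u :: "real \<Rightarrow> real"
  proof -
    have "integrable (lebesgue_on {a..b}) (\<lambda>x. \<phi> x + u x)"
      by (rule integrable_mono_on) (use u in \<open>fastforce simp: mono_on_def\<close>)
    moreover have "integrable (lebesgue_on {a..b}) \<phi>"
      by (rule integrable_mono_on) (use majorizesD(2)[OF m] in \<open>auto simp: mono_on_def\<close>)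
    ultimately have "integrable (lebesgue_on {a..b}) (\<lambda>x. (\<phi> x + u x) - \<phi> x)"
      by (rule Bochner_Integration.integrable_diff)
    then show ?thesis by simp
  qed
  have "integrable (lebesgue_on {a..b}) (\<lambda>x. Re (f x))" "integrable (lebesgue_on {a..b}) (\<lambda>x. Im (f x))"
    using majorizesD(1)[OF m] abs_Re_le_cmod abs_Im_le_cmod
    by (intro aux; (metis minus_complex.sel order_trans))+
  then have "integrable (lebesgue_on {a..b}) (\<lambda>x. of_real (Re (f x)) + \<i> * of_real (Im (f x)))"
    by (intro Bochner_Integration.integrable_add integrable_mult_right integrable_of_real)
  then show ?thesis
    by (simp flip: complex_eq)
qed

lemma AE_lebesgue_on_iff_negligible:
  assumes "S \<in> sets lebesgue"
  shows "(AE x in lebesgue_on S. P x) \<longleftrightarrow> negligible {x \<in> S. \<not> P x}"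
proof -
  have "(AE x in lebesgue_on S. P x) \<longleftrightarrow> (AE x in lebesgue. x \<in> S \<longrightarrow> P x)"
    using assms by (intro AE_restrict_space_iff) auto
  also have "\<dots> \<longleftrightarrow> negligible {x. \<not> (x \<in> S \<longrightarrow> P x)}"
    by (simp add: negligible_iff_null_sets completion.AE_iff_null_sets) 
  finally show ?thesis by (simp add: conj_commute)
qed

lemma integrable_lebesgue_on_AE_eq:
  fixes f g :: "real \<Rightarrow> complex"
  assumes "integrable (lebesgue_on {a..b}) f" "AE x in lebesgue_on {a..b}. f x = g x"
  shows "integrable (lebesgue_on {a..b}) g"
proof -
  have eq: "integrable (lebesgue_on {a..b}) h \<longleftrightarrow> h absolutely_integrable_on {a..b}" for h :: "real \<Rightarrow> complex"
    by (simp add: set_integrable_def integrable_restrict_space)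
  have "f absolutely_integrable_on {a..b}"
    using assms(1) eq by blast
  moreover have "negligible {x \<in> {a..b}. f x \<noteq> g x}"
    using assms(2) by (simp add: AE_lebesgue_on_iff_negligible)
  ultimately have "g absolutely_integrable_on {a..b}"
    by (rule absolutely_integrable_spike) auto
  then show ?thesis
    using eq by blast
qed

text \<open>The new majorant jumps by \<open>cmod (u l)\<close> on entering the interval at
  \<open>l\<close>, follows \<open>\<psi>\<close> up to and including \<open>r\<close>, and jumps by
  \<open>cmod (u r)\<close> just after \<open>r\<close>, where the truncated function drops to
  zero.\<close>

lemma majorizes_extend_zero:
  assumes m: "majorizes l r \<psi> u" and "a \<le> l" "l \<le> r" "r \<le> b"
  obtains \<Psi> where "majorizes a b \<Psi> (\<lambda>x. u x * indicator {l..r} x)"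
    "\<Psi> b - \<Psi> a \<le> cmod (u l) + cmod (u r) + (\<psi> r - \<psi> l)"
proof
  define \<Psi> where "\<Psi> x = (if x < l then 0 else if x \<le> r then cmod (u l) + (\<psi> x - \<psi> l)
    else cmod (u l) + cmod (u r) + (\<psi> r - \<psi> l))" for x
  have le: "\<psi> x \<le> \<psi> y" if "l \<le> x" "x \<le> y" "y \<le> r" for x y
    using majorizesD(2)[OF m] that by blast
  have diff: "cmod (u y - u x) \<le> \<psi> y - \<psi> x" if "l \<le> x" "x \<le> y" "y \<le> r" for x y
    using majorizesD(1)[OF m] that by blast
  have from_l: "cmod (u x) \<le> cmod (u l) + (\<psi> x - \<psi> l)" if "l \<le> x" "x \<le> r" for x
    using diff[of l x] norm_triangle_sub[of "u x" "u l"] that by auto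
  have to_r: "cmod (u x) \<le> cmod (u r) + (\<psi> r - \<psi> x)" if "l \<le> x" "x \<le> r" for x
    using diff[of x r] norm_triangle_sub[of "u x" "u r"] that by (auto simp: norm_minus_commute)
  show "majorizes a b \<Psi> (\<lambda>x. u x * indicator {l..r} x)"
    unfolding majorizes_def
  proof (intro allI impI)
    fix x y assume xy: "a \<le> x" "x \<le> y" "y \<le> b"
    consider "y < l" | "x < l" "l \<le> y" "y \<le> r" | "x < l" "r < y" | "l \<le> x" "y \<le> r" | "l \<le> x" "x \<le> r" "r < y" | "r < x"
      using xy by linarith
    then show "cmod (u y * indicator {l..r} y - u x * indicator {l..r} x) \<le> \<Psi> y - \<Psi> x"
    proof cases
      case 2 then show ?thesis using from_l[of y] by (simp add: \<Psi>_def)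
    next
      case 3 then show ?thesis using le[of l r] assms by (simp add: \<Psi>_def)
    next
      case 4 then show ?thesis using diff[of x y] xy by (simp add: \<Psi>_def)
    next
      case 5 then show ?thesis using to_r[of x] by (simp add: \<Psi>_def)
    qed (use xy assms in \<open>auto simp: \<Psi>_def\<close>)
  qed
  show "\<Psi> b - \<Psi> a \<le> cmod (u l) + cmod (u r) + (\<psi> r - \<psi> l)"
    using le[of l r] assms by (auto simp: \<Psi>_def)
qed

text \<open>Induction removes the interval with the largest left endpoint \<open>p m\<close>. All
  others end before \<open>p m\<close>, so the induction hypothesis applies on
  \<open>{a..p m}\<close>; this is why \<open>b\<close> is generalized.\<close>

lemma sum_increments_le:
  fixes \<psi> :: "real \<Rightarrow> real"
  assumes "finite F" "mono_on {a..b} \<psi>" "a \<le> b"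
    and "\<And>i. i \<in> F \<Longrightarrow> a \<le> p i \<and> p i < q i \<and> q i \<le> b"
    and "\<And>i j. i \<in> F \<Longrightarrow> j \<in> F \<Longrightarrow> i \<noteq> j \<Longrightarrow> q i \<le> p j \<or> q j \<le> p i"
  shows "(\<Sum>i\<in>F. \<psi> (q i) - \<psi> (p i)) \<le> \<psi> b - \<psi> a"
  using assms
proof (induction F arbitrary: b rule: finite_ranking_induct[where f = p])
  case empty
  then show ?case by (auto simp: mono_on_def)
next
  case (insert m F)
  show ?case
  proof (cases "m \<in> F")
    case True
    then show ?thesis using insert by (simp add: insert_absorb)
  next
    case False
    have m: "a \<le> p m" "p m < q m" "q m \<le> b" using insert.prems(3) by auto
    have "q j \<le> p m" if "j \<in> F" for j
      using insert.prems(4)[of j m] insert.hyps(2)[of j] insert.prems(3)[of j] m that False by force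
    moreover have "mono_on {a..p m} \<psi>"
      using insert.prems(1) by (rule mono_on_subset) (use m in auto)
    ultimately have "(\<Sum>i\<in>F. \<psi> (q i) - \<psi> (p i)) \<le> \<psi> (p m) - \<psi> a"
      using insert.prems(3,4) m(1) by (intro insert.IH) auto
    moreover have "\<psi> (q m) \<le> \<psi> b"
      using insert.prems(1) m by (auto simp: mono_on_def)
    ultimately show ?thesis
      using insert.hyps(1) False by simp
  qed
qed

text \<open>Substitute for the mean value theorem without continuity. If the norm exceeded its mean
  everywhere on \<open>{s..t}\<close>, the difference would be positive with integral zero, hence
  zero almost everywhere on an interval of positive length.\<close>

lemma mean_value_norm:
  assumes m: "majorizes a b \<phi> f" and st: "a \<le> s" "s < t" "t \<le> b"
  obtains y where "s \<le> y" "y \<le> t" "cmod (f y) * (t - s) \<le> integral {s..t} (\<lambda>x. cmod (f x))"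
proof -
  define I where "I = integral {s..t} (\<lambda>x. cmod (f x))"
  have m': "majorizes s t \<phi> f"
    using m st by (auto simp: majorizes_def)
  have int: "integrable (lebesgue_on {s..t}) (\<lambda>x. cmod (f x))"
    using majorizes_integrable[OF m'] by auto
  have "\<exists>y\<in>{s..t}. cmod (f y) * (t - s) \<le> I"
  proof (rule ccontr)
    assume "\<not> (\<exists>y\<in>{s..t}. cmod (f y) * (t - s) \<le> I)"
    then have less: "I / (t - s) < cmod (f y)" if "y \<in> {s..t}" for y
      using that st by (auto simp: field_simps not_le)
    have "(integral\<^sup>L (lebesgue_on {s..t}) (\<lambda>x. cmod (f x) - I / (t - s))) = I - I / (t - s) * (t - s)"
      using int st by (simp add: lebesgue_integral_eq_integral I_def measure_restrict_space)
    also have "\<dots> = 0" using st by simp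
    finally have "AE x in lebesgue_on {s..t}. cmod (f x) - I / (t - s) = 0"
      using int less by (subst (asm) integral_nonneg_eq_0_iff_AE) (auto intro!: AE_I2 less_imp_le)
    then have "negligible {x \<in> {s..t}. cmod (f x) - I / (t - s) \<noteq> 0}"
      by (simp add: AE_lebesgue_on_iff_negligible)
    also have "{x \<in> {s..t}. cmod (f x) - I / (t - s) \<noteq> 0} = {s..t}"
      using less by force
    finally show False
      using st negligible_interval(1)[of s t] by (simp add: box_real)
  qed
  then show ?thesis
    using that I_def by auto
qed

lemma majorizes_norm_integrable_on:
  assumes "majorizes a b \<phi> f"
  shows "(\<lambda>x. cmod (f x)) integrable_on {a..b}"
  using majorizes_integrable[OF assms] by (intro integrable_on_lebesgue_on integrable_norm) auto

lemma integral_norm_increment: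
  assumes "majorizes a b \<phi> f" "a \<le> s" "s \<le> t" "t \<le> b"
  shows "integral {a..t} (\<lambda>x. cmod (f x)) - integral {a..s} (\<lambda>x. cmod (f x)) = integral {s..t} (\<lambda>x. cmod (f x))"
proof -
  have "(\<lambda>x. cmod (f x)) integrable_on {a..t}"
    using majorizes_norm_integrable_on[OF assms(1)] by (rule integrable_on_subinterval) (use assms in auto)
  from Henstock_Kurzweil_Integration.integral_combine[OF assms(2,3) this] show ?thesis by simp
qed

lemma mono_on_integral_norm:
  assumes "majorizes a b \<phi> f"
  shows "mono_on {a..b} (\<lambda>x. integral {a..x} (\<lambda>y. cmod (f y)))"
proof (rule mono_onI)
  fix s t assume st: "s \<in> {a..b}" "t \<in> {a..b}" "s \<le> t"
  have "0 \<le> integral {s..t} (\<lambda>x. cmod (f x))"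
    by (rule integral_nonneg[OF integrable_on_subinterval[OF majorizes_norm_integrable_on[OF assms]]])
      (use st in auto)
  then show "integral {a..s} (\<lambda>y. cmod (f y)) \<le> integral {a..t} (\<lambda>y. cmod (f y))"
    using integral_norm_increment[OF assms, of s t] st by auto
qed

text \<open>The preimage is closed by continuity, bounded, and order-convex by monotonicity, hence a
  compact interval, possibly empty. The sign \<open>\<sigma>\<close> treats increasing and
  decreasing maps together.\<close>

lemma monotone_vimage_interval:
  fixes h :: "real \<Rightarrow> real"
  assumes cont: "continuous_on {l..r} h" and \<sigma>: "\<sigma> \<in> {1, -1}"
    and mono: "\<forall>x\<in>{l..r}. \<forall>y\<in>{l..r}. x \<le> y \<longrightarrow> \<sigma> * h x \<le> \<sigma> * h y"
  shows "\<exists>p q. {x \<in> {l..r}. h x \<in> {l'..r'}} = {p..q}"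
proof -
  let ?X = "{x \<in> {l..r}. h x \<in> {l'..r'}}"
  have "?X = {l..r} \<inter> h -` {l'..r'}" by auto
  moreover have "closed ({l..r} \<inter> h -` {l'..r'})"
    by (rule continuous_closed_preimage[OF cont]) auto
  ultimately have "closed ?X" by simp
  moreover have "bounded ?X"
    by (rule bounded_subset[of "{l..r}"]) auto
  moreover have "is_interval ?X"
    unfolding is_interval_1
  proof (intro ballI allI impI)
    fix x y z assume x: "x \<in> ?X" and y: "y \<in> ?X" and z: "x \<le> z \<and> z \<le> y"
    then have mem: "x \<in> {l..r}" "y \<in> {l..r}" "z \<in> {l..r}" by auto
    have "\<sigma> * h x \<le> \<sigma> * h z" "\<sigma> * h z \<le> \<sigma> * h y"
      using mono mem z by blast+
    then show "z \<in> ?X" using \<sigma> x y mem by auto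
  qed
  ultimately show ?thesis
    by (simp add: connected_compact_interval_1[symmetric] compact_eq_bounded_closed is_interval_connected_1)
qed

section \<open>Norms and infima over representatives\<close>

lemma L1_norm_AE_eq:
  assumes m: "majorizes a b \<phi> g" and fg: "AE x in lebesgue_on {a..b}. g x = f x"
  shows "L1_norm a b f = ennreal (integral {a..b} (\<lambda>x. cmod (g x)))"
proof -
  have int: "integrable (lebesgue_on {a..b}) (\<lambda>x. cmod (g x))"
    using majorizes_integrable[OF m] by (rule integrable_norm)
  have "L1_norm a b f = (\<integral>\<^sup>+x. ennreal (cmod (g x)) \<partial>lebesgue_on {a..b})"
    unfolding L1_norm_def using fg by (intro nn_integral_cong_AE) (auto elim: eventually_mono)
  also have "\<dots> = ennreal (integral\<^sup>L (lebesgue_on {a..b}) (\<lambda>x. cmod (g x)))"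
    using int by (intro nn_integral_eq_integral) auto
  also have "integral\<^sup>L (lebesgue_on {a..b}) (\<lambda>x. cmod (g x)) = integral {a..b} (\<lambda>x. cmod (g x))"
    using int by (intro lebesgue_integral_eq_integral) auto
  finally show ?thesis .
qed

text \<open>Passes from single representatives to the infimum. Attainment is avoided by taking a
  representative within \<open>e / \<rho>\<close> of the infimum, which costs \<open>e\<close> after
  multiplication by \<open>\<rho>\<close>.\<close>

lemma le_mult_ess_var_add:
  assumes \<rho>: "0 < \<rho>" and fin: "ess_var a b f < \<infinity>"
    and le: "\<And>g. AE x in lebesgue_on {a..b}. g x = f x \<Longrightarrow> total_variation a b g < \<infinity> \<Longrightarrow>
      X \<le> ennreal \<rho> * total_variation a b g + Y"
  shows "X \<le> ennreal \<rho> * ess_var a b f + Y"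
proof (rule ennreal_le_epsilon)
  fix e :: real assume e: "0 < e"
  then have "0 < ennreal (e / \<rho>)" using \<rho> by simp
  then have "ess_var a b f < ess_var a b f + ennreal (e / \<rho>)"
    using fin by (simp add: ennreal_lessI less_top)
  then obtain g where g: "AE x in lebesgue_on {a..b}. g x = f x"
    "total_variation a b g < ess_var a b f + ennreal (e / \<rho>)"
    unfolding ess_var_def[of a b f] INF_less_iff by blast
  have "total_variation a b g < \<infinity>"
    using g(2) fin by (metis ennreal_add_less_top ennreal_less_top infinity_ennreal_def order_less_trans)
  then have "X \<le> ennreal \<rho> * total_variation a b g + Y"
    by (rule le[OF g(1)])
  also have "\<dots> \<le> ennreal \<rho> * (ess_var a b f + ennreal (e / \<rho>)) + Y"
    using g(2) by (intro add_mono mult_left_mono) auto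
  also have "\<dots> = ennreal \<rho> * ess_var a b f + Y + ennreal e"
    using \<rho> e by (simp add: distrib_left ennreal_mult[symmetric] algebra_simps)
  finally show "X \<le> ennreal \<rho> * ess_var a b f + Y + ennreal e" .
qed

section \<open>Systems of inverse branches\<close>

text \<open>
  \<open>D i\<close> is the domain of the inverse branch \<open>h i\<close>, and \<open>(v i)\<^sup>2\<close> is the modulus of its derivative.
  The assumptions \<open>h_diff\<close> and \<open>v_diff\<close> are phrased without derivatives so that they pass to
  compositions by pure algebra.
\<close>

locale branch_system =
  fixes a b t K :: real and S :: "'i set" and D :: "'i \<Rightarrow> real set" and h v :: "'i \<Rightarrow> real \<Rightarrow> real"
  assumes a_less_b: "a < b" and t_nonneg: "0 \<le> t" and K_nonneg: "0 \<le> K"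
    and countable_index: "countable S"
    and finite_domains: "finite (D ` S)"
    and domain: "i \<in> S \<Longrightarrow> \<exists>l r. a \<le> l \<and> l < r \<and> r \<le> b \<and> D i = {l..r}"
    and h_range: "i \<in> S \<Longrightarrow> x \<in> D i \<Longrightarrow> h i x \<in> {a..b}"
    and h_monotone: "i \<in> S \<Longrightarrow> \<exists>\<sigma>\<in>{1, -1}. \<forall>x\<in>D i. \<forall>y\<in>D i. x \<le> y \<longrightarrow> \<sigma> * h i x \<le> \<sigma> * h i y"
    and v_pos: "i \<in> S \<Longrightarrow> x \<in> D i \<Longrightarrow> 0 < v i x"
    and v_le: "i \<in> S \<Longrightarrow> x \<in> D i \<Longrightarrow> v i x \<le> t"
    and h_diff: "i \<in> S \<Longrightarrow> x \<in> D i \<Longrightarrow> y \<in> D i \<Longrightarrow> \<bar>h i x - h i y\<bar> = \<bar>x - y\<bar> * v i x * v i y"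
    and v_diff: "i \<in> S \<Longrightarrow> x \<in> D i \<Longrightarrow> y \<in> D i \<Longrightarrow> \<bar>v i x - v i y\<bar> \<le> K * \<bar>x - y\<bar> * v i x"
    and non_overlapping: "i \<in> S \<Longrightarrow> j \<in> S \<Longrightarrow> y \<noteq> z \<Longrightarrow> {y, z} \<subseteq> h i ` D i \<Longrightarrow> {y, z} \<subseteq> h j ` D j \<Longrightarrow> i = j"
begin

section \<open>Distortion, ranges and summability of the branches\<close>

definition distortion :: real where
  "distortion = 1 + K * (b - a)"

lemma distortion_ge_1: "1 \<le> distortion"
  using K_nonneg a_less_b by (simp add: distortion_def)

lemma v_le_distortion:
  assumes "i \<in> S" "x \<in> D i" "y \<in> D i"
  shows "v i x \<le> distortion * v i y"
proof -
  obtain l r where lr: "a \<le> l" "r \<le> b" "D i = {l..r}" using domain[OF assms(1)] by blast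
  have "v i x - v i y \<le> K * \<bar>y - x\<bar> * v i y"
    using v_diff[OF assms(1,3,2)] by linarith
  also have "\<dots> \<le> K * (b - a) * v i y"
    using assms lr v_pos[OF assms(1,3)] K_nonneg by (intro mult_right_mono mult_left_mono) auto
  finally show ?thesis by (simp add: distortion_def algebra_simps)
qed

lemma h_lipschitz:
  assumes "i \<in> S" "x \<in> D i" "y \<in> D i"
  shows "\<bar>h i x - h i y\<bar> \<le> t\<^sup>2 * \<bar>x - y\<bar>"
proof -
  have "v i x * v i y \<le> t * t"
    using assms v_le v_pos t_nonneg by (intro mult_mono) (auto intro: less_imp_le)
  from mult_left_mono[OF this, of "\<bar>x - y\<bar>"] show ?thesis
    by (simp add: h_diff[OF assms] power2_eq_square algebra_simps)
qed

lemma h_inj: "i \<in> S \<Longrightarrow> inj_on (h i) (D i)"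
proof (rule inj_onI)
  fix x y assume *: "i \<in> S" "x \<in> D i" "y \<in> D i" "h i x = h i y"
  then show "x = y"
    using h_diff[OF *(1-3)] v_pos[OF *(1,2)] v_pos[OF *(1,3)] by auto
qed

lemma h_continuous: "i \<in> S \<Longrightarrow> continuous_on (D i) (h i)"
  by (rule lipschitz_on_continuous_on[of "t\<^sup>2"])
    (simp add: lipschitz_on_def dist_real_def h_lipschitz)

definition lo :: "'i \<Rightarrow> real" where "lo i = Inf (h i ` D i)"
definition hi :: "'i \<Rightarrow> real" where "hi i = Sup (h i ` D i)"

lemma range_interval:
  assumes i: "i \<in> S"
  shows "h i ` D i = {lo i..hi i}" "lo i < hi i" "a \<le> lo i" "hi i \<le> b"
proof -
  obtain l r where lr: "l < r" "D i = {l..r}" using domain[OF i] by blast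
  have "connected (h i ` D i)" "compact (h i ` D i)"
    using h_continuous[OF i] lr by (auto intro: connected_continuous_image compact_continuous_image)
  then have "\<exists>p q. h i ` D i = {p..q}"
    by (simp only: connected_compact_interval_1[symmetric] simp_thms)
  then obtain p q where pq: "h i ` D i = {p..q}"
    by (elim exE)
  have "h i l \<noteq> h i r"
    using h_inj[OF i] lr by (auto dest: inj_onD)
  moreover have mem: "h i l \<in> {p..q}" "h i r \<in> {p..q}"
    using lr pq by auto
  ultimately have "p < q" by auto
  then have eq: "lo i = p" "hi i = q"
    by (simp_all add: lo_def hi_def pq)
  show "h i ` D i = {lo i..hi i}" "lo i < hi i"
    using pq \<open>p < q\<close> by (simp_all add: eq)
  have "h i ` D i \<subseteq> {a..b}"
    using h_range[OF i] by blast
  then show "a \<le> lo i" "hi i \<le> b"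
    unfolding pq eq using \<open>p < q\<close> by auto
qed

text \<open>A monotone map attains its extreme values at the ends of its domain; the two
  alternatives are the increasing and the decreasing case.\<close>

lemma endpoints:
  assumes i: "i \<in> S" and D: "D i = {l..r}" "l < r"
  shows "h i l = lo i \<and> h i r = hi i \<or> h i l = hi i \<and> h i r = lo i"
proof -
  obtain \<sigma> where \<sigma>: "\<sigma> \<in> {1, -1}" and mono: "\<And>x y. x \<in> D i \<Longrightarrow> y \<in> D i \<Longrightarrow> x \<le> y \<Longrightarrow> \<sigma> * h i x \<le> \<sigma> * h i y"
    using h_monotone[OF i] by blast
  have lr: "l \<in> D i" "r \<in> D i" using D by auto
  have "lo i \<in> h i ` D i" "hi i \<in> h i ` D i"
    using range_interval[OF i] by auto
  then obtain x y where xy: "x \<in> D i" "y \<in> D i" "h i x = lo i" "h i y = hi i" by auto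
  have "h i l \<in> {lo i..hi i}" "h i r \<in> {lo i..hi i}"
    using range_interval(1)[OF i] lr by auto
  then have bounds: "lo i \<le> h i l" "h i l \<le> hi i" "lo i \<le> h i r" "h i r \<le> hi i" by auto
  have "l \<le> x" "l \<le> y" "x \<le> r" "y \<le> r" using xy D by auto
  with xy(1,2) lr have "\<sigma> * h i l \<le> \<sigma> * h i x" "\<sigma> * h i x \<le> \<sigma> * h i r"
    "\<sigma> * h i l \<le> \<sigma> * h i y" "\<sigma> * h i y \<le> \<sigma> * h i r"
    by (blast intro: mono)+
  then show ?thesis
    using \<sigma> bounds unfolding xy(3,4) by auto
qed

text \<open>If neither range preceded the other, they would share the nondegenerate interval from
  \<open>y\<close> to \<open>z\<close>. Two distinct common points are exactly what
  \<open>non_overlapping\<close> forbids, while ranges may still share one endpoint.\<close>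

lemma ranges_ordered:
  assumes "i \<in> S" "j \<in> S" "i \<noteq> j"
  shows "hi i \<le> lo j \<or> hi j \<le> lo i"
proof (rule ccontr)
  assume "\<not> ?thesis"
  moreover define y z where "y = max (lo i) (lo j)" "z = min (hi i) (hi j)"
  ultimately have "y < z"
    using range_interval(2)[OF assms(1)] range_interval(2)[OF assms(2)] by auto
  moreover have "{y, z} \<subseteq> h i ` D i" "{y, z} \<subseteq> h j ` D j"
    unfolding range_interval(1)[OF assms(1)] range_interval(1)[OF assms(2)]
    using \<open>y < z\<close> by (auto simp: y_z_def)
  ultimately have "i = j"
    by (intro non_overlapping[OF assms(1,2), of y z]) simp_all
  with assms(3) show False ..
qed

lemma sum_range_increments:
  fixes \<psi> :: "real \<Rightarrow> real"
  assumes "finite F" "F \<subseteq> S" "mono_on {a..b} \<psi>"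
  shows "(\<Sum>i\<in>F. \<psi> (hi i) - \<psi> (lo i)) \<le> \<psi> b - \<psi> a"
proof (rule sum_increments_le[where p = lo and q = hi and F = F and \<psi> = \<psi> and a = a and b = b])
  show "a \<le> lo i \<and> lo i < hi i \<and> hi i \<le> b" if "i \<in> F" for i
    using range_interval[of i] assms(2) that by blast
  show "hi i \<le> lo j \<or> hi j \<le> lo i" if "i \<in> F" "j \<in> F" "i \<noteq> j" for i j
    using ranges_ordered[of i j] assms(2) that by blast
qed (use assms a_less_b in auto)

lemma range_increment_nonneg:
  fixes \<psi> :: "real \<Rightarrow> real"
  assumes "i \<in> S" "mono_on {a..b} \<psi>"
  shows "0 \<le> \<psi> (hi i) - \<psi> (lo i)"
  using mono_onD[OF assms(2), of "lo i" "hi i"] range_interval(2-4)[OF assms(1)] by simp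

lemma range_increments_summable:
  fixes \<psi> :: "real \<Rightarrow> real"
  assumes "mono_on {a..b} \<psi>"
  shows "(\<lambda>i. \<psi> (hi i) - \<psi> (lo i)) summable_on S"
    and "(\<Sum>\<^sub>\<infinity>i\<in>S. \<psi> (hi i) - \<psi> (lo i)) \<le> \<psi> b - \<psi> a"
proof -
  show "(\<lambda>i. \<psi> (hi i) - \<psi> (lo i)) summable_on S"
    using assms sum_range_increments range_increment_nonneg
    by (intro nonneg_bdd_above_summable_on bdd_aboveI2[of _ _ "\<psi> b - \<psi> a"]) auto
  then show "(\<Sum>\<^sub>\<infinity>i\<in>S. \<psi> (hi i) - \<psi> (lo i)) \<le> \<psi> b - \<psi> a"
    using assms sum_range_increments by (intro infsum_le_finite_sums) auto
qed

lemma domain_length_bound: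
  obtains \<delta> where "0 < \<delta>" "\<And>i l r. i \<in> S \<Longrightarrow> D i = {l..r} \<Longrightarrow> l < r \<Longrightarrow> \<delta> \<le> r - l"
proof
  \<comment> \<open>The element 1 keeps the set nonempty, so that \<open>Min\<close> is meaningful
    even without branches.\<close>
  let ?L = "insert 1 ((\<lambda>E. Sup E - Inf E) ` D ` S)"
  have fin: "finite ?L" using finite_domains by blast
  have "0 < x" if x: "x \<in> ?L" for x
    using x domain by force
  then show "0 < Min ?L"
    using fin by (subst Min_gr_iff) blast+
  show "Min ?L \<le> r - l" if "i \<in> S" "D i = {l..r}" "l < r" for i l r
  proof (rule Min_le[OF fin])
    have "r - l = Sup (D i) - Inf (D i)" using that by simp
    then show "r - l \<in> ?L" using that(1) by blast
  qed
qed

text \<open>By \<open>h_diff\<close> at the two ends of the domain, \<open>v i l * v i r\<close> is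
  the length of the range divided by that of the domain. Distortion compares
  \<open>(v i x)\<^sup>2\<close> with this product, and domain lengths are bounded below uniformly
  in \<open>i\<close>.\<close>

lemma weight_bound:
  obtains C where "0 \<le> C" "\<And>i x. i \<in> S \<Longrightarrow> x \<in> D i \<Longrightarrow> (v i x)\<^sup>2 \<le> C * (hi i - lo i)"
proof -
  obtain \<delta> where \<delta>: "0 < \<delta>" "\<And>i l r. i \<in> S \<Longrightarrow> D i = {l..r} \<Longrightarrow> l < r \<Longrightarrow> \<delta> \<le> r - l"
    using domain_length_bound by blast
  show ?thesis
  proof
    show "0 \<le> distortion\<^sup>2 / \<delta>" using \<delta> by simp
    fix i x assume i: "i \<in> S" and x: "x \<in> D i"
    obtain l r where lr: "l < r" "D i = {l..r}" using domain[OF i] by blast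
    have mem: "l \<in> D i" "r \<in> D i" using lr by auto
    have "(v i x)\<^sup>2 \<le> (distortion * v i l) * (distortion * v i r)"
      unfolding power2_eq_square
      using v_le_distortion[OF i x] mem v_pos[OF i] x distortion_ge_1
      by (intro mult_mono) (auto intro!: mult_nonneg_nonneg less_imp_le)
    also have "\<dots> = distortion\<^sup>2 * (v i l * v i r)"
      by (simp add: power2_eq_square)
    also have "\<dots> \<le> distortion\<^sup>2 * ((hi i - lo i) / \<delta>)"
    proof (intro mult_left_mono)
      have "\<delta> * (v i l * v i r) \<le> (r - l) * (v i l * v i r)"
        using \<delta>(2)[OF i lr(2,1)] v_pos[OF i] mem by (intro mult_right_mono) (auto intro: less_imp_le)
      also have "\<dots> = \<bar>h i l - h i r\<bar>"
        using h_diff[OF i mem] lr by simp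
      also have "\<dots> = hi i - lo i"
        using endpoints[OF i lr(2,1)] range_interval(2)[OF i] by auto
      finally show "v i l * v i r \<le> (hi i - lo i) / \<delta>"
        using \<delta>(1) by (simp add: field_simps)
    qed auto
    finally show "(v i x)\<^sup>2 \<le> distortion\<^sup>2 / \<delta> * (hi i - lo i)" by simp
  qed
qed

section \<open>The branch sum and its variation\<close>

definition branch_term :: "'i \<Rightarrow> (real \<Rightarrow> complex) \<Rightarrow> real \<Rightarrow> complex" where
  "branch_term i f x = of_real ((v i x)\<^sup>2) * f (h i x) * indicator (D i) x"

definition branch_sum :: "(real \<Rightarrow> complex) \<Rightarrow> real \<Rightarrow> complex" where
  "branch_sum f x = (\<Sum>\<^sub>\<infinity>i\<in>S. branch_term i f x)"

text \<open>A Weierstrass majorant: \<open>W\<close> depends neither on the point nor on the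
  function. It is a multiple of the range lengths, which are summable because the ranges do not
  overlap.\<close>

lemma branch_term_bound:
  "\<exists>W. W summable_on S \<and> (\<forall>i\<in>S. 0 \<le> W i) \<and>
    (\<forall>i\<in>S. \<forall>x f B. (\<forall>y\<in>{a..b}. cmod (f y) \<le> B) \<longrightarrow> cmod (branch_term i f x) \<le> W i * B)"
proof -
  obtain C where C: "0 \<le> C" "\<And>i x. i \<in> S \<Longrightarrow> x \<in> D i \<Longrightarrow> (v i x)\<^sup>2 \<le> C * (hi i - lo i)"
    using weight_bound by blast
  have nonneg: "0 \<le> C * (hi i - lo i)" if "i \<in> S" for i
    using C(1) range_interval(2)[OF that] by simp
  show ?thesis
  proof (intro exI[of _ "\<lambda>i. C * (hi i - lo i)"] conjI ballI allI impI)
    have "(\<lambda>i. id (hi i) - id (lo i)) summable_on S"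
      by (rule range_increments_summable) (auto simp: mono_on_def)
    then show "(\<lambda>i. C * (hi i - lo i)) summable_on S"
      by (simp add: summable_on_cmult_right)
    show "0 \<le> C * (hi i - lo i)" if "i \<in> S" for i using nonneg[OF that] .
  next
    fix i x B and f :: "real \<Rightarrow> complex"
    assume i: "i \<in> S" and "\<forall>y\<in>{a..b}. cmod (f y) \<le> B"
    then have B: "\<And>y. y \<in> {a..b} \<Longrightarrow> cmod (f y) \<le> B" by blast
    have "0 \<le> B"
      using order_trans[OF norm_ge_zero B[of a]] a_less_b by auto
    then show "cmod (branch_term i f x) \<le> C * (hi i - lo i) * B"
      using C(2)[OF i, of x] B[OF h_range[OF i]] nonneg[OF i]
      by (cases "x \<in> D i") (auto simp: branch_term_def norm_mult norm_power intro!: mult_mono)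
  qed
qed

lemma branch_terms_summable:
  assumes "\<And>y. y \<in> {a..b} \<Longrightarrow> cmod (f y) \<le> B"
  shows "(\<lambda>i. cmod (branch_term i f x)) summable_on S"
proof -
  obtain W where W: "W summable_on S"
    "\<forall>i\<in>S. \<forall>x f B. (\<forall>y\<in>{a..b}. cmod (f y) \<le> B) \<longrightarrow> cmod (branch_term i f x) \<le> W i * B"
    using branch_term_bound by blast
  from W(1) have "(\<lambda>i. W i * B) summable_on S"
    by (rule summable_on_cmult_left)
  then show ?thesis
    by (rule summable_on_comparison_test) (use W(2) assms in auto)
qed

text \<open>
  The increment of the potential over the range of a branch bounds the variation of its contribution
  to the transfer operator; the increments telescope, because the ranges do not overlap.
\<close>

definition potential :: "real \<Rightarrow> (real \<Rightarrow> real) \<Rightarrow> (real \<Rightarrow> complex) \<Rightarrow> real \<Rightarrow> real" where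
  "potential M \<phi> f x = 2 * t\<^sup>2 * \<phi> x + M * integral {a..x} (\<lambda>y. cmod (f y))"

lemma mono_on_potential:
  assumes "majorizes a b \<phi> f" "0 \<le> M"
  shows "mono_on {a..b} (potential M \<phi> f)"
proof (rule mono_onI)
  fix x y assume xy: "x \<in> {a..b}" "y \<in> {a..b}" "x \<le> y"
  show "potential M \<phi> f x \<le> potential M \<phi> f y"
    unfolding potential_def
    using majorizesD(2)[OF assms(1), of x y] mono_onD[OF mono_on_integral_norm[OF assms(1)] xy] xy assms(2)
    by (intro add_mono mult_left_mono) auto
qed

text \<open>The product is controlled along the range of \<open>h i\<close> by
  \<open>\<eta>\<close>, which charges changes of \<open>f\<close> to \<open>\<phi>\<close> and
  changes of the weight to the integral of the norm; \<open>\<eta>\<close> is then pulled back by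
  \<open>h i\<close>.\<close>

lemma weighted_branch_majorant:
  assumes i: "i \<in> S" and m: "majorizes a b \<phi> f" and D: "D i = {l..r}" "l < r"
  obtains \<psi> where "majorizes l r \<psi> (\<lambda>x. of_real ((v i x)\<^sup>2) * f (h i x))"
    "\<psi> r - \<psi> l \<le> t\<^sup>2 * (\<phi> (hi i) - \<phi> (lo i)) + K * (1 + distortion) * integral {lo i..hi i} (\<lambda>x. cmod (f x))"
proof -
  let ?\<Phi> = "\<lambda>x. integral {a..x} (\<lambda>y. cmod (f y))"
  define \<eta> where "\<eta> x = t\<^sup>2 * \<phi> x + K * (1 + distortion) * ?\<Phi> x" for x
  have increment: "cmod (of_real ((v i x)\<^sup>2) * f (h i x) - of_real ((v i y)\<^sup>2) * f (h i y)) \<le> \<eta> (h i y) - \<eta> (h i x)"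
    if x: "x \<in> D i" and y: "y \<in> D i" and less: "h i x < h i y" for x y
  proof -
    have bounds: "a \<le> h i x" "h i y \<le> b"
      using h_range[OF i] x y by auto
    \<comment> \<open>Since \<open>z\<close> lies between the two images, the oscillations of
      \<open>f\<close> on both sides of it add up to a single increment of \<open>\<phi>\<close>;
      since \<open>cmod (f z)\<close> is at most the mean, it can be paid for by the integral over
      the same interval.\<close>
    obtain z where z: "h i x \<le> z" "z \<le> h i y"
      "cmod (f z) * (h i y - h i x) \<le> integral {h i x..h i y} (\<lambda>x. cmod (f x))"
      using mean_value_norm[OF m bounds(1) less bounds(2)] by blast
    have v2: "(v i x)\<^sup>2 \<le> t\<^sup>2" "(v i y)\<^sup>2 \<le> t\<^sup>2"
      using v_le[OF i] v_pos[OF i] x y by (auto intro!: power_mono intro: less_imp_le)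
    have "\<bar>(v i x)\<^sup>2 - (v i y)\<^sup>2\<bar> = \<bar>v i x - v i y\<bar> * (v i x + v i y)"
      using v_pos[OF i x] v_pos[OF i y] by (simp add: power2_eq_square square_diff_square_factored abs_mult)
    also have "\<dots> \<le> (K * \<bar>x - y\<bar> * v i x) * (distortion * v i y + v i y)"
      using v_diff[OF i x y] v_le_distortion[OF i x y] v_pos[OF i x] v_pos[OF i y] K_nonneg
      by (intro mult_mono) auto
    \<comment> \<open>The factor \<open>\<bar>x - y\<bar> * v i x * v i y\<close> is the distance of
      the images by \<open>h_diff\<close>, so the change of the weight is measured on the range
      rather than on the domain.\<close>
    also have "\<dots> = K * (1 + distortion) * (h i y - h i x)"
      using h_diff[OF i x y] less by (simp add: algebra_simps)
    finally have "\<bar>(v i x)\<^sup>2 - (v i y)\<^sup>2\<bar> * cmod (f z) \<le> K * (1 + distortion) * (h i y - h i x) * cmod (f z)"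
      by (rule mult_right_mono) auto
    also have "\<dots> = K * (1 + distortion) * (cmod (f z) * (h i y - h i x))" by simp
    also have "\<dots> \<le> K * (1 + distortion) * (?\<Phi> (h i y) - ?\<Phi> (h i x))"
      using z(3) integral_norm_increment[OF m, of "h i x" "h i y"] bounds less K_nonneg distortion_ge_1
      by (intro mult_left_mono) auto
    finally have weights: "\<bar>(v i x)\<^sup>2 - (v i y)\<^sup>2\<bar> * cmod (f z) \<le> K * (1 + distortion) * (?\<Phi> (h i y) - ?\<Phi> (h i x))" .
    have "of_real ((v i x)\<^sup>2) * f (h i x) - of_real ((v i y)\<^sup>2) * f (h i y)
       = of_real ((v i x)\<^sup>2) * (f (h i x) - f z) + of_real ((v i y)\<^sup>2) * (f z - f (h i y))
         + of_real ((v i x)\<^sup>2 - (v i y)\<^sup>2) * f z"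
      by (simp add: algebra_simps)
    also have "cmod \<dots> \<le> (v i x)\<^sup>2 * cmod (f (h i x) - f z) + (v i y)\<^sup>2 * cmod (f z - f (h i y))
         + \<bar>(v i x)\<^sup>2 - (v i y)\<^sup>2\<bar> * cmod (f z)"
      by (intro norm_triangle_le add_mono) (simp_all add: norm_mult norm_power flip: of_real_diff of_real_power)
    also have "\<dots> \<le> t\<^sup>2 * (\<phi> z - \<phi> (h i x)) + t\<^sup>2 * (\<phi> (h i y) - \<phi> z)
         + K * (1 + distortion) * (?\<Phi> (h i y) - ?\<Phi> (h i x))"
      using v2 weights majorizesD(1)[OF m, of "h i x" z] majorizesD(1)[OF m, of z "h i y"] bounds z
      by (intro add_mono[OF add_mono weights] mult_mono) (auto simp: norm_minus_commute)
    also have "\<dots> = \<eta> (h i y) - \<eta> (h i x)"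
      by (simp add: \<eta>_def algebra_simps)
    finally show ?thesis .
  qed
  obtain \<sigma> where \<sigma>: "\<sigma> \<in> {1, -1}" and mono: "\<And>x y. x \<in> D i \<Longrightarrow> y \<in> D i \<Longrightarrow> x \<le> y \<Longrightarrow> \<sigma> * h i x \<le> \<sigma> * h i y"
    using h_monotone[OF i] by blast
  \<comment> \<open>The sign restores monotonicity when \<open>h i\<close> is decreasing.\<close>
  have "majorizes l r (\<lambda>x. \<sigma> * \<eta> (h i x)) (\<lambda>x. of_real ((v i x)\<^sup>2) * f (h i x))"
    unfolding majorizes_def
  proof (intro allI impI)
    fix x y assume "l \<le> x" "x \<le> y" "y \<le> r"
    then have xy: "x \<in> D i" "y \<in> D i" "\<sigma> * h i x \<le> \<sigma> * h i y"
      using D mono[of x y] by auto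
    consider "x = y" | "h i x < h i y" "\<sigma> = 1" | "h i y < h i x" "\<sigma> = -1"
    proof (cases "x = y")
      case False
      then have "h i x \<noteq> h i y" using h_inj[OF i] xy by (auto dest: inj_onD)
      then show ?thesis using that xy(3) \<sigma> by auto
    qed
    then show "cmod (of_real ((v i y)\<^sup>2) * f (h i y) - of_real ((v i x)\<^sup>2) * f (h i x)) \<le> \<sigma> * \<eta> (h i y) - \<sigma> * \<eta> (h i x)"
    proof cases
      case 2 with increment[OF xy(1,2)] show ?thesis by (simp add: norm_minus_commute)
    next
      case 3 with increment[OF xy(2,1)] show ?thesis by simp
    qed simp
  qed
  moreover have "\<sigma> * \<eta> (h i r) - \<sigma> * \<eta> (h i l) = \<eta> (hi i) - \<eta> (lo i)"
    using endpoints[OF i D] range_interval(2)[OF i] mono[of l r] D \<sigma> by auto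
  moreover have "\<dots> = t\<^sup>2 * (\<phi> (hi i) - \<phi> (lo i)) + K * (1 + distortion) * integral {lo i..hi i} (\<lambda>x. cmod (f x))"
    using range_interval(2-4)[OF i]
    by (subst integral_norm_increment[OF m, symmetric]) (simp_all add: \<eta>_def algebra_simps)
  ultimately show ?thesis using that by simp
qed

text \<open>Truncation to the domain adds the norms of the two end values to the interior variation.
  Comparison with one mean point \<open>z\<close> bounds them by a second \<open>t\<^sup>2\<close>
  times the increment of \<open>\<phi>\<close>, whence the factor 2, and by \<open>2 * C\<close>
  times the integral, whence the second summand of \<open>M\<close>.\<close>

lemma branch_term_majorant:
  assumes i: "i \<in> S" and m: "majorizes a b \<phi> f"
    and C: "0 \<le> C" "\<And>i x. i \<in> S \<Longrightarrow> x \<in> D i \<Longrightarrow> (v i x)\<^sup>2 \<le> C * (hi i - lo i)"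
    and M: "M = K * (1 + distortion) + 2 * C"
  obtains \<Psi> where "majorizes a b \<Psi> (branch_term i f)"
    "\<Psi> b - \<Psi> a \<le> potential M \<phi> f (hi i) - potential M \<phi> f (lo i)"
proof -
  let ?I = "integral {lo i..hi i} (\<lambda>x. cmod (f x))"
  let ?u = "\<lambda>x. of_real ((v i x)\<^sup>2) * f (h i x)"
  obtain l r where lr: "a \<le> l" "l < r" "r \<le> b" and D: "D i = {l..r}" using domain[OF i] by blast
  obtain \<psi> where \<psi>: "majorizes l r \<psi> ?u"
    "\<psi> r - \<psi> l \<le> t\<^sup>2 * (\<phi> (hi i) - \<phi> (lo i)) + K * (1 + distortion) * ?I"
    using weighted_branch_majorant[OF i m D lr(2)] by blast
  obtain \<Psi> where \<Psi>: "majorizes a b \<Psi> (\<lambda>x. ?u x * indicator {l..r} x)"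
    "\<Psi> b - \<Psi> a \<le> cmod (?u l) + cmod (?u r) + (\<psi> r - \<psi> l)"
    using majorizes_extend_zero[OF \<psi>(1) lr(1) less_imp_le[OF lr(2)] lr(3)] by blast
  note range = range_interval(2-4)[OF i]
  obtain z where z: "lo i \<le> z" "z \<le> hi i" "cmod (f z) * (hi i - lo i) \<le> ?I"
    using mean_value_norm[OF m range(2,1,3)] by blast
  have mem: "l \<in> D i" "r \<in> D i" using D lr by auto
  have weighted: "cmod (?u x) \<le> t\<^sup>2 * cmod (f (h i x) - f z) + C * ?I" if x: "x \<in> D i" for x
  proof -
    have "cmod (?u x) = (v i x)\<^sup>2 * cmod (f (h i x))"
      by (simp add: norm_mult norm_power)
    also have "\<dots> \<le> (v i x)\<^sup>2 * (cmod (f (h i x) - f z) + cmod (f z))"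
      using norm_triangle_sub[of "f (h i x)" "f z"] by (intro mult_left_mono) auto
    also have "\<dots> = (v i x)\<^sup>2 * cmod (f (h i x) - f z) + (v i x)\<^sup>2 * cmod (f z)"
      by (simp add: algebra_simps)
    also have "\<dots> \<le> t\<^sup>2 * cmod (f (h i x) - f z) + C * (hi i - lo i) * cmod (f z)"
      using v_le[OF i x] v_pos[OF i x] C(2)[OF i x]
      by (intro add_mono mult_right_mono power_mono) auto
    also have "C * (hi i - lo i) * cmod (f z) \<le> C * ?I"
      using mult_left_mono[OF z(3) C(1)] by (simp add: algebra_simps)
    finally show ?thesis by simp
  qed
  have "cmod (f (lo i) - f z) \<le> \<phi> z - \<phi> (lo i)"
    using majorizesD(1)[OF m range(2) z(1)] z range by (simp add: norm_minus_commute)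
  moreover have "cmod (f (hi i) - f z) \<le> \<phi> (hi i) - \<phi> z"
    using majorizesD(1)[OF m _ z(2) range(3)] z range by simp
  \<comment> \<open>Using the same \<open>z\<close> for both ends is essential: the two increments
    meet at \<open>z\<close> and together cost only one increment of \<open>\<phi>\<close>.\<close>
  ultimately have "cmod (f (h i l) - f z) + cmod (f (h i r) - f z) \<le> \<phi> (hi i) - \<phi> (lo i)"
    using endpoints[OF i D lr(2)] by auto
  from mult_left_mono[OF this, of "t\<^sup>2"] have "cmod (?u l) + cmod (?u r) \<le> t\<^sup>2 * (\<phi> (hi i) - \<phi> (lo i)) + 2 * C * ?I"
    using weighted[OF mem(1)] weighted[OF mem(2)] by (simp add: algebra_simps)
  with \<Psi>(2) \<psi>(2) have "\<Psi> b - \<Psi> a \<le> 2 * t\<^sup>2 * (\<phi> (hi i) - \<phi> (lo i)) + M * ?I"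
    by (simp add: M algebra_simps)
  also have "\<dots> = potential M \<phi> f (hi i) - potential M \<phi> f (lo i)"
    using range
    by (subst integral_norm_increment[OF m, symmetric]) (simp_all add: potential_def algebra_simps)
  finally have "\<Psi> b - \<Psi> a \<le> potential M \<phi> f (hi i) - potential M \<phi> f (lo i)" .
  moreover have "branch_term i f = (\<lambda>x. ?u x * indicator {l..r} x)"
    by (simp add: fun_eq_iff branch_term_def D)
  ultimately show ?thesis
    using \<Psi>(1) that by simp
qed

text \<open>The majorants of the individual terms are summed. Their total increments are bounded by
  increments of the potential over non-overlapping ranges; \<open>M\<close> is fixed before
  \<open>f\<close> and \<open>\<phi>\<close>.\<close>

lemma branch_sum_majorant:
  obtains M where "0 \<le> M"
    "\<And>\<phi> f. majorizes a b \<phi> f \<Longrightarrow> \<exists>\<Psi>. majorizes a b \<Psi> (branch_sum f) \<and>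
      \<Psi> b - \<Psi> a \<le> 2 * t\<^sup>2 * (\<phi> b - \<phi> a) + M * integral {a..b} (\<lambda>x. cmod (f x))"
proof -
  obtain C where C: "0 \<le> C" "\<And>i x. i \<in> S \<Longrightarrow> x \<in> D i \<Longrightarrow> (v i x)\<^sup>2 \<le> C * (hi i - lo i)"
    using weight_bound by blast
  define M where "M = K * (1 + distortion) + 2 * C"
  have M: "0 \<le> M"
    using K_nonneg distortion_ge_1 C(1) by (simp add: M_def)
  show ?thesis
  proof (rule that[OF M])
    fix \<phi> f assume m: "majorizes a b \<phi> f"
    define \<psi> where "\<psi> = potential M \<phi> f"
    have \<psi>: "mono_on {a..b} \<psi>"
      using mono_on_potential[OF m M] by (simp add: \<psi>_def)
    have "\<exists>\<Psi>. majorizes a b \<Psi> (branch_term i f) \<and> \<Psi> b - \<Psi> a \<le> \<psi> (hi i) - \<psi> (lo i)" if "i \<in> S" for i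
      unfolding \<psi>_def using branch_term_majorant[OF that m C M_def] by metis
    then obtain \<Psi> where \<Psi>: "\<And>i. i \<in> S \<Longrightarrow> majorizes a b (\<Psi> i) (branch_term i f)"
      "\<And>i. i \<in> S \<Longrightarrow> \<Psi> i b - \<Psi> i a \<le> \<psi> (hi i) - \<psi> (lo i)"
      by metis
    have \<Psi>_mono: "\<Psi> i x \<le> \<Psi> i y" if "i \<in> S" "a \<le> x" "x \<le> y" "y \<le> b" for i x y
      using majorizesD(2)[OF \<Psi>(1)] that by blast
    have summable: "(\<lambda>i. \<Psi> i x - \<Psi> i a) summable_on S" if "a \<le> x" "x \<le> b" for x
    proof (rule summable_on_comparison_test[OF range_increments_summable(1)[OF \<psi>]])
      show "\<Psi> i x - \<Psi> i a \<le> \<psi> (hi i) - \<psi> (lo i)" if "i \<in> S" for i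
        using \<Psi>(2)[OF that] \<Psi>_mono[of i x b] that \<open>a \<le> x\<close> \<open>x \<le> b\<close> by auto
      show "0 \<le> \<Psi> i x - \<Psi> i a" if "i \<in> S" for i
        using \<Psi>_mono[of i a x] that \<open>a \<le> x\<close> \<open>x \<le> b\<close> by auto
    qed
    \<comment> \<open>Majorants are determined only up to constants; normalizing each to vanish at
      \<open>a\<close> makes the series one of nonnegative, summable terms.\<close>
    define \<Psi>' where "\<Psi>' x = (\<Sum>\<^sub>\<infinity>i\<in>S. \<Psi> i x - \<Psi> i a)" for x
    have terms: "(\<lambda>i. branch_term i f x) summable_on S" for x
      by (rule abs_summable_summable[OF branch_terms_summable[OF majorizes_bounded[OF m]]])
    have "majorizes a b \<Psi>' (branch_sum f)"
      unfolding majorizes_def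
    proof (intro allI impI)
      fix x y assume xy: "a \<le> x" "x \<le> y" "y \<le> b"
      have "((\<lambda>i. branch_term i f y - branch_term i f x) has_sum (branch_sum f y - branch_sum f x)) S"
        unfolding branch_sum_def diff_conv_add_uminus
        by (intro has_sum_add has_sum_uminusI has_sum_infsum terms)
      moreover have "((\<lambda>i. (\<Psi> i y - \<Psi> i a) - (\<Psi> i x - \<Psi> i a)) has_sum (\<Psi>' y - \<Psi>' x)) S"
        unfolding \<Psi>'_def diff_conv_add_uminus[of "infsum _ _"] diff_conv_add_uminus[of "_ - _" "_ - _"]
        by (intro has_sum_add has_sum_uminusI has_sum_infsum summable) (use xy in auto)
      ultimately show "cmod (branch_sum f y - branch_sum f x) \<le> \<Psi>' y - \<Psi>' x"
        by (rule norm_infsum_le) (use majorizesD(1)[OF \<Psi>(1)] xy in auto)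
    qed
    moreover have "\<Psi>' b - \<Psi>' a = \<Psi>' b"
      by (simp add: \<Psi>'_def)
    moreover have "\<dots> \<le> (\<Sum>\<^sub>\<infinity>i\<in>S. \<psi> (hi i) - \<psi> (lo i))"
      unfolding \<Psi>'_def using a_less_b \<Psi>(2) range_increments_summable(1)[OF \<psi>]
      by (intro infsum_mono summable) auto
    moreover have "\<dots> \<le> \<psi> b - \<psi> a"
      by (rule range_increments_summable(2)[OF \<psi>])
    moreover have "\<dots> = 2 * t\<^sup>2 * (\<phi> b - \<phi> a) + M * integral {a..b} (\<lambda>x. cmod (f x))"
      by (simp add: \<psi>_def potential_def algebra_simps)
    ultimately show "\<exists>\<Psi>. majorizes a b \<Psi> (branch_sum f) \<and>
      \<Psi> b - \<Psi> a \<le> 2 * t\<^sup>2 * (\<phi> b - \<phi> a) + M * integral {a..b} (\<lambda>x. cmod (f x))"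
      by (intro exI[of _ \<Psi>']) simp
  qed
qed

section \<open>Derivatives, change of variables and null sets\<close>

lemma h_has_field_derivative:
  assumes i: "i \<in> S"
  obtains \<sigma> where "\<bar>\<sigma>\<bar> = 1" "\<And>x. x \<in> D i \<Longrightarrow> (h i has_field_derivative \<sigma> * (v i x)\<^sup>2) (at x within D i)"
proof -
  obtain \<sigma> where \<sigma>: "\<sigma> \<in> {1, -1}" and mono: "\<And>x y. x \<in> D i \<Longrightarrow> y \<in> D i \<Longrightarrow> x \<le> y \<Longrightarrow> \<sigma> * h i x \<le> \<sigma> * h i y"
    using h_monotone[OF i] by blast
  have v_cont: "continuous_on (D i) (v i)"
  proof (rule lipschitz_on_continuous_on[of "K * t"], rule lipschitz_onI)
    fix x y assume xy: "x \<in> D i" "y \<in> D i"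
    have "K * \<bar>x - y\<bar> * v i x \<le> K * \<bar>x - y\<bar> * t"
      using v_le[OF i xy(1)] K_nonneg by (intro mult_left_mono) auto
    with v_diff[OF i xy] show "dist (v i x) (v i y) \<le> K * t * dist x y"
      by (simp add: dist_real_def algebra_simps)
  qed (use K_nonneg t_nonneg in auto)
  show ?thesis
  proof
    show "\<bar>\<sigma>\<bar> = 1" using \<sigma> by auto
    fix x assume x: "x \<in> D i"
    have "((\<lambda>y. \<sigma> * (v i x * v i y)) \<longlongrightarrow> \<sigma> * (v i x * v i x)) (at x within D i)"
      using v_cont x by (intro tendsto_intros) (auto simp: continuous_on_def)
    \<comment> \<open>With the sign from monotonicity, \<open>h_diff\<close> gives the difference
      quotient exactly, and only continuity of \<open>v i\<close> is left for the limit.\<close>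
    moreover have "\<forall>\<^sub>F y in at x within D i. \<sigma> * (v i x * v i y) = (h i y - h i x) / (y - x)"
      unfolding eventually_at_filter
    proof (intro always_eventually allI impI)
      fix y assume y: "y \<noteq> x" "y \<in> D i"
      have pos: "0 < v i x * v i y" using v_pos[OF i] x y by simp
      have diff: "\<bar>h i y - h i x\<bar> = \<bar>y - x\<bar> * (v i x * v i y)"
        using h_diff[OF i y(2) x] by (simp add: algebra_simps)
      have "h i y - h i x = \<sigma> * (v i x * v i y) * (y - x)"
      proof (cases "x \<le> y")
        case True
        then have "0 \<le> \<sigma> * (h i y - h i x)"
          using mono[OF x y(2)] by (simp add: algebra_simps)
        with True diff \<sigma> show ?thesis by (auto simp: algebra_simps)
      next
        case False
        then have "0 \<le> \<sigma> * (h i x - h i y)"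
          using mono[OF y(2) x] by (simp add: algebra_simps)
        with False diff \<sigma> show ?thesis by (auto simp: algebra_simps)
      qed
      with y show "\<sigma> * (v i x * v i y) = (h i y - h i x) / (y - x)" by simp
    qed
    ultimately have "((\<lambda>y. (h i y - h i x) / (y - x)) \<longlongrightarrow> \<sigma> * (v i x * v i x)) (at x within D i)"
      by (rule Lim_transform_eventually)
    then show "(h i has_field_derivative \<sigma> * (v i x)\<^sup>2) (at x within D i)"
      by (simp add: has_field_derivative_iff power2_eq_square)
  qed
qed

lemma norm_branch_term:
  "cmod (branch_term i f x) = (if x \<in> D i then (v i x)\<^sup>2 * cmod (f (h i x)) else 0)"
  by (simp add: branch_term_def norm_mult norm_power)

lemma branch_term_integral:
  assumes i: "i \<in> S" and m: "majorizes a b \<phi> f"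
  shows "(\<lambda>x. cmod (branch_term i f x)) integrable_on {a..b}"
    and "integral {a..b} (\<lambda>x. cmod (branch_term i f x)) = integral {lo i..hi i} (\<lambda>x. cmod (f x))"
proof -
  obtain \<sigma> where \<sigma>: "\<bar>\<sigma>\<bar> = 1" "\<And>x. x \<in> D i \<Longrightarrow> (h i has_field_derivative \<sigma> * (v i x)\<^sup>2) (at x within D i)"
    using h_has_field_derivative[OF i] by blast
  have "D i \<in> sets lebesgue" "D i \<subseteq> {a..b}"
    using domain[OF i] by auto
  note range = range_interval[OF i]
  have "(\<lambda>x. cmod (f x)) integrable_on {lo i..hi i}"
    using majorizes_norm_integrable_on[OF m] by (rule integrable_on_subinterval) (use range in auto)
  then have "(\<lambda>x. cmod (f x)) absolutely_integrable_on h i ` D i"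
    by (simp add: range(1) absolutely_integrable_on_iff_nonneg)
  then have *: "(\<lambda>x. \<bar>\<sigma> * (v i x)\<^sup>2\<bar> * cmod (f (h i x))) absolutely_integrable_on D i \<and>
      integral (D i) (\<lambda>x. \<bar>\<sigma> * (v i x)\<^sup>2\<bar> * cmod (f (h i x))) = integral {lo i..hi i} (\<lambda>x. cmod (f x))"
    using has_absolute_integral_change_of_variables_1'[OF \<open>D i \<in> sets lebesgue\<close> \<sigma>(2) h_inj[OF i],
        of "\<lambda>x. cmod (f x)" "integral {lo i..hi i} (\<lambda>x. cmod (f x))"]
    by (simp add: range(1))
  have "(\<lambda>x. (v i x)\<^sup>2 * cmod (f (h i x))) integrable_on D i"
    using set_lebesgue_integral_eq_integral(1)[OF conjunct1[OF *]] by (simp add: abs_mult \<sigma>(1))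
  then show "(\<lambda>x. cmod (branch_term i f x)) integrable_on {a..b}"
    using \<open>D i \<subseteq> {a..b}\<close> unfolding norm_branch_term integrable_restrict_Int by (simp add: Int_absorb2)
  show "integral {a..b} (\<lambda>x. cmod (branch_term i f x)) = integral {lo i..hi i} (\<lambda>x. cmod (f x))"
    using \<open>D i \<subseteq> {a..b}\<close> conjunct2[OF *] unfolding norm_branch_term integral_restrict_Int
    by (simp add: Int_absorb2 abs_mult \<sigma>(1))
qed

text \<open>The operator is a contraction in the integral norm. Interchanging an infinite sum with
  the integral is avoided: finitely many terms suffice up to a uniform error
  \<open>e / (b - a)\<close>, and each term integrates by change of variables to the integral over
  its range.\<close>

lemma branch_sum_integral_le:
  assumes m: "majorizes a b \<phi> f"
  shows "integral {a..b} (\<lambda>x. cmod (branch_sum f x)) \<le> integral {a..b} (\<lambda>x. cmod (f x))"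
proof (rule field_le_epsilon)
  fix e :: real assume e: "0 < e"
  define B where "B = cmod (f a) + (\<phi> b - \<phi> a)"
  have B: "\<forall>y\<in>{a..b}. cmod (f y) \<le> B"
    using majorizes_bounded[OF m] by (simp add: B_def)
  obtain W where W: "W summable_on S"
    "\<forall>i\<in>S. \<forall>x f B. (\<forall>y\<in>{a..b}. cmod (f y) \<le> B) \<longrightarrow> cmod (branch_term i f x) \<le> W i * B"
    using branch_term_bound by blast
  have WB: "(\<lambda>i. W i * B) summable_on S"
    using W(1) by (rule summable_on_cmult_left)
  have terms: "(\<lambda>i. cmod (branch_term i f x)) summable_on S" for x
    by (rule branch_terms_summable[OF majorizes_bounded[OF m]])
  obtain F where F: "finite F" "F \<subseteq> S" "dist (\<Sum>i\<in>F. W i * B) (\<Sum>\<^sub>\<infinity>i\<in>S. W i * B) \<le> e / (b - a)"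
    using infsum_finite_approximation[OF WB, of "e / (b - a)"] e a_less_b by auto
  have pointwise: "cmod (branch_sum f x) \<le> (\<Sum>i\<in>F. cmod (branch_term i f x)) + e / (b - a)" for x
  proof -
    \<comment> \<open>The differences are nonnegative, so their partial sum over \<open>F\<close> is
      at most their total; thus the tail of the terms is at most the tail of \<open>W i * B\<close>,
      uniformly in \<open>x\<close>.\<close>
    have "((\<lambda>i. W i * B - cmod (branch_term i f x)) has_sum
        ((\<Sum>\<^sub>\<infinity>i\<in>S. W i * B) - (\<Sum>\<^sub>\<infinity>i\<in>S. cmod (branch_term i f x)))) S"
      unfolding diff_conv_add_uminus
      by (intro has_sum_add has_sum_uminusI has_sum_infsum WB terms)
    then have "(\<Sum>i\<in>F. W i * B - cmod (branch_term i f x))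
        \<le> (\<Sum>\<^sub>\<infinity>i\<in>S. W i * B) - (\<Sum>\<^sub>\<infinity>i\<in>S. cmod (branch_term i f x))"
      using W(2) B by (rule_tac finite_sum_le_has_sum[OF _ F(1,2)]) auto
    moreover have "cmod (branch_sum f x) \<le> (\<Sum>\<^sub>\<infinity>i\<in>S. cmod (branch_term i f x))"
      unfolding branch_sum_def by (rule norm_infsum_bound[OF terms])
    ultimately show ?thesis
      using F(3) by (simp add: sum_subtractf dist_real_def)
  qed
  obtain \<Psi> where \<Psi>: "majorizes a b \<Psi> (branch_sum f)"
    using branch_sum_majorant m by metis
  have sum_int: "(\<lambda>x. \<Sum>i\<in>F. cmod (branch_term i f x)) integrable_on {a..b}"
    using F branch_term_integral(1)[OF _ m] by (intro integrable_sum) auto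
  have "integral {a..b} (\<lambda>x. cmod (branch_sum f x))
      \<le> integral {a..b} (\<lambda>x. (\<Sum>i\<in>F. cmod (branch_term i f x)) + e / (b - a))"
    using pointwise sum_int
    by (intro integral_le majorizes_norm_integrable_on[OF \<Psi>] integrable_add) (auto intro: integrable_const_ivl)
  also have "\<dots> = integral {a..b} (\<lambda>x. \<Sum>i\<in>F. cmod (branch_term i f x)) + integral {a..b} (\<lambda>x. e / (b - a))"
    by (intro Henstock_Kurzweil_Integration.integral_add sum_int) (auto intro: integrable_const_ivl)
  also have "integral {a..b} (\<lambda>x. e / (b - a)) = e"
    using a_less_b by simp
  also have "integral {a..b} (\<lambda>x. \<Sum>i\<in>F. cmod (branch_term i f x)) = (\<Sum>i\<in>F. integral {lo i..hi i} (\<lambda>x. cmod (f x)))"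
    using F branch_term_integral[OF _ m]
    by (subst Henstock_Kurzweil_Integration.integral_sum) (auto intro!: sum.cong)
  also have "\<dots> = (\<Sum>i\<in>F. integral {a..hi i} (\<lambda>x. cmod (f x)) - integral {a..lo i} (\<lambda>x. cmod (f x)))"
    using F(2) range_interval(2-4)
    by (intro sum.cong refl integral_norm_increment[OF m, symmetric]) (auto intro: less_imp_le)
  also have "\<dots> \<le> integral {a..b} (\<lambda>x. cmod (f x)) - integral {a..a} (\<lambda>x. cmod (f x))"
    by (rule sum_range_increments[OF F(1,2) mono_on_integral_norm[OF m]])
  finally show "integral {a..b} (\<lambda>x. cmod (branch_sum f x)) \<le> integral {a..b} (\<lambda>x. cmod (f x)) + e"
    by simp
qed

text \<open>The preimage is the image of a null set under the inverse of \<open>h i\<close>. By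
  distortion \<open>v i\<close> is bounded below by some \<open>c > 0\<close> on the domain, so
  \<open>h_diff\<close> makes the inverse Lipschitz with constant
  \<open>1 / c\<^sup>2\<close>.\<close>

lemma negligible_branch_vimage:
  assumes i: "i \<in> S" and N: "negligible N"
  shows "negligible {x \<in> D i. h i x \<in> N}"
proof -
  obtain l r where lr: "l < r" "D i = {l..r}" using domain[OF i] by blast
  have l: "l \<in> D i" using lr by auto
  define c where "c = v i l / distortion"
  have c: "0 < c" "\<And>x. x \<in> D i \<Longrightarrow> c \<le> v i x"
    using v_le_distortion[OF i l] v_pos[OF i l] distortion_ge_1 by (auto simp: c_def field_simps)
  let ?g = "inv_into (D i) (h i)"
  have "negligible (?g ` (N \<inter> h i ` D i))"
  proof (rule negligible_locally_Lipschitz_image)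
    show "negligible (N \<inter> h i ` D i)"
      using N by (rule negligible_subset) auto
    fix y assume y: "y \<in> N \<inter> h i ` D i"
    have "norm (?g z - ?g y) \<le> 1 / c\<^sup>2 * norm (z - y)" if z: "z \<in> N \<inter> h i ` D i" for z
    proof -
      have mem: "?g y \<in> D i" "?g z \<in> D i" "h i (?g y) = y" "h i (?g z) = z"
        using y z by (auto simp: inv_into_into f_inv_into_f)
      have "c\<^sup>2 * \<bar>?g z - ?g y\<bar> \<le> (v i (?g z) * v i (?g y)) * \<bar>?g z - ?g y\<bar>"
        using c(1) c(2)[OF mem(1)] c(2)[OF mem(2)]
        by (auto simp: power2_eq_square intro!: mult_right_mono mult_mono)
      also have "\<dots> = \<bar>z - y\<bar>"
        using h_diff[OF i mem(2,1)] mem by simp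
      finally show ?thesis using c(1) by (simp add: field_simps)
    qed
    then show "\<exists>T B. open T \<and> y \<in> T \<and> (\<forall>z\<in>(N \<inter> h i ` D i) \<inter> T. norm (?g z - ?g y) \<le> B * norm (z - y))"
      by (intro exI[of _ UNIV] exI[of _ "1 / c\<^sup>2"]) auto
  qed simp
  moreover have "{x \<in> D i. h i x \<in> N} \<subseteq> ?g ` (N \<inter> h i ` D i)"
    using h_inj[OF i] by (auto simp: image_iff intro!: bexI inv_into_f_f[symmetric])
  ultimately show ?thesis by (rule negligible_subset)
qed

text \<open>The operator is well defined on classes: the sums can differ only where some branch hits
  the exceptional set, a countable union of null sets.\<close>

lemma branch_sum_AE_cong:
  assumes "AE x in lebesgue_on {a..b}. f x = g x"
  shows "AE x in lebesgue_on {a..b}. branch_sum f x = branch_sum g x"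
proof -
  let ?N = "{x \<in> {a..b}. f x \<noteq> g x}"
  have N: "negligible ?N"
    using assms by (simp add: AE_lebesgue_on_iff_negligible)
  have "negligible (\<Union>i\<in>S. {x \<in> D i. h i x \<in> ?N})"
    using countable_index negligible_branch_vimage[OF _ N] by (intro negligible_countable_Union) auto
  moreover have "{x \<in> {a..b}. branch_sum f x \<noteq> branch_sum g x} \<subseteq> (\<Union>i\<in>S. {x \<in> D i. h i x \<in> ?N})"
  proof (rule subsetI, rule ccontr)
    fix x assume x: "x \<in> {x \<in> {a..b}. branch_sum f x \<noteq> branch_sum g x}" "x \<notin> (\<Union>i\<in>S. {x \<in> D i. h i x \<in> ?N})"
    have "branch_term i f x = branch_term i g x" if "i \<in> S" for i
      using x(2) that h_range[OF that, of x] by (auto simp: branch_term_def indicator_def)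
    then have "branch_sum f x = branch_sum g x"
      unfolding branch_sum_def by (rule infsum_cong)
    with x(1) show False by simp
  qed
  ultimately have "negligible {x \<in> {a..b}. branch_sum f x \<noteq> branch_sum g x}"
    by (rule negligible_subset)
  then show ?thesis
    by (simp add: AE_lebesgue_on_iff_negligible)
qed

lemma abs_vector_derivative_h:
  assumes i: "i \<in> S" and x: "x \<in> D i"
  shows "\<bar>vector_derivative (h i) (at x within D i)\<bar> = (v i x)\<^sup>2"
proof -
  obtain \<sigma> where \<sigma>: "\<bar>\<sigma>\<bar> = 1" "\<And>x. x \<in> D i \<Longrightarrow> (h i has_field_derivative \<sigma> * (v i x)\<^sup>2) (at x within D i)"
    using h_has_field_derivative[OF i] by blast
  obtain l r where lr: "l < r" "D i = {l..r}" using domain[OF i] by blast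
  have "(h i has_vector_derivative \<sigma> * (v i x)\<^sup>2) (at x within D i)"
    using \<sigma>(2)[OF x] by (simp add: has_real_derivative_iff_has_vector_derivative)
  then have "vector_derivative (h i) (at x within D i) = \<sigma> * (v i x)\<^sup>2"
    using vector_derivative_within_cbox[of l r x "h i"] lr x by simp
  then show ?thesis using \<sigma>(1) by (simp add: abs_mult)
qed

subsection \<open>Compositions of branches\<close>

text \<open>The head acts first, so that prepending a letter corresponds to applying the operator
  once more from the outside.\<close>

primrec word_domain :: "'i list \<Rightarrow> real set" where
  "word_domain [] = {a..b}"
| "word_domain (i # w) = {x \<in> D i. h i x \<in> word_domain w}"

primrec word_map :: "'i list \<Rightarrow> real \<Rightarrow> real" where
  "word_map [] = (\<lambda>x. x)"
| "word_map (i # w) = (\<lambda>x. word_map w (h i x))"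

text \<open>By the chain rule, this is the square root of the modulus of the derivative of the
  composed branch.\<close>

primrec word_weight :: "'i list \<Rightarrow> real \<Rightarrow> real" where
  "word_weight [] = (\<lambda>x. 1)"
| "word_weight (i # w) = (\<lambda>x. v i x * word_weight w (h i x))"

text \<open>
  Words with a domain of at most one point are left out, since domain lengths must be bounded
  from below. They affect the iterated transfer operator only on a countable set.
\<close>

primrec words :: "nat \<Rightarrow> 'i list set" where
  "words 0 = {[]}"
| "words (Suc n) = {i # w | i w. i \<in> S \<and> w \<in> words n \<and> (\<exists>x\<in>word_domain (i # w). \<exists>y\<in>word_domain (i # w). x < y)}"

text \<open>
  The domain of the word \<open>i # w\<close> differs from \<open>D i\<close> only if an endpoint of the domain of \<open>w\<close> lies in
  the interior of the range of \<open>h i\<close>, which for each endpoint happens for at most one \<open>i\<close>. Hence there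
  are only finitely many domains of words of a given length.
\<close>

lemma finite_straddling: "finite {i \<in> S. lo i < e \<and> e < hi i}"
proof (rule finite_subset)
  show "{i \<in> S. lo i < e \<and> e < hi i} \<subseteq> {SOME i. i \<in> S \<and> lo i < e \<and> e < hi i}"
  proof (rule subsetI, rule singletonI[THEN rev_iffD1])
    fix i assume i: "i \<in> {i \<in> S. lo i < e \<and> e < hi i}"
    let ?j = "SOME i. i \<in> S \<and> lo i < e \<and> e < hi i"
    have "?j \<in> S \<and> lo ?j < e \<and> e < hi ?j"
      by (rule someI[of _ i]) (use i in simp)
    with i have "i = ?j" using ranges_ordered[of i ?j] by force
    then show "(i \<in> {i}) = (i \<in> {?j})" by simp
  qed
qed simp

text \<open>Two points in the word domain give two distinct points common to \<open>{l..r}\<close>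
  and the range of \<open>h i\<close>. The overlap is thus nondegenerate, so unless the range lies
  inside \<open>{l..r}\<close>, one of \<open>l\<close>, \<open>r\<close> is interior to it.\<close>

lemma word_domain_Cons_cases:
  assumes i: "i \<in> S" and w: "word_domain w = {l..r}" and x: "x \<in> word_domain (i # w)" and y: "y \<in> word_domain (i # w)" "x < y"
  shows "word_domain (i # w) = D i \<or> lo i < l \<and> l < hi i \<or> lo i < r \<and> r < hi i"
proof -
  have mem: "x \<in> D i" "y \<in> D i" "l \<le> h i x" "l \<le> h i y" "h i x \<le> r" "h i y \<le> r"
    using x y w by auto
  then have "h i x \<noteq> h i y"
    using h_inj[OF i] y by (auto dest: inj_onD)
  moreover have "h i x \<in> {lo i..hi i}" "h i y \<in> {lo i..hi i}"
    using mem range_interval(1)[OF i] by blast+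
  moreover have "word_domain (i # w) = D i" if "l \<le> lo i" "hi i \<le> r"
  proof -
    have "h i z \<in> {l..r}" if "z \<in> D i" for z
      using imageI[OF that, of "h i"] \<open>l \<le> lo i\<close> \<open>hi i \<le> r\<close> unfolding range_interval(1)[OF i] by auto
    then show ?thesis by (auto simp: w)
  qed
  ultimately show ?thesis using mem by fastforce
qed

text \<open>Induction on the length, prepending one branch. Weights multiply, giving
  \<open>t ^ n\<close>; distortion constants add, giving \<open>n * K\<close>, because
  \<open>t \<le> 1\<close> keeps the inner branch from expanding distances.\<close>

lemma words_branch_system:
  assumes "t \<le> 1"
  shows "branch_system a b (t ^ n) (n * K) (words n) word_domain word_map word_weight"
proof (induction n)
  case 0
  have "\<exists>l\<ge>a. \<exists>r>l. r \<le> b \<and> {a..b} = {l..r}"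
    using a_less_b by auto
  then show ?case
    using a_less_b by unfold_locales (auto intro: bexI[of _ 1])
next
  case (Suc n)
  interpret W: branch_system a b "t ^ n" "n * K" "words n" word_domain word_map word_weight
    by (rule Suc)
  have wordsE: "\<exists>i w. u = i # w \<and> i \<in> S \<and> w \<in> words n \<and> (\<exists>x\<in>word_domain u. \<exists>y\<in>word_domain u. x < y)"
    if "u \<in> words (Suc n)" for u
    using that by (auto simp del: word_domain.simps)
  show ?case
  proof
    show "a < b" by (rule a_less_b)
    show "0 \<le> t ^ Suc n" using t_nonneg by simp
    show "0 \<le> real (Suc n) * K" using K_nonneg by simp
    have "words (Suc n) \<subseteq> (\<lambda>(i, w). i # w) ` (S \<times> words n)" by auto
    then show "countable (words (Suc n))"
      by (rule countable_subset) (use countable_index W.countable_index in auto)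
    \<comment> \<open>The truncated domains: preimages of \<open>E\<close> under the finitely many
      branches whose range has an end of \<open>E\<close> in its interior.\<close>
    let ?F = "\<lambda>E. (\<lambda>i. {x \<in> D i. h i x \<in> E}) ` ({i \<in> S. lo i < Inf E \<and> Inf E < hi i} \<union> {i \<in> S. lo i < Sup E \<and> Sup E < hi i})"
    have "word_domain ` words (Suc n) \<subseteq> D ` S \<union> (\<Union>E\<in>word_domain ` words n. ?F E)"
    proof (rule image_subsetI)
      fix u assume "u \<in> words (Suc n)"
      then obtain i w x y where u: "u = i # w" "i \<in> S" "w \<in> words n" and xy: "x \<in> word_domain u" "y \<in> word_domain u" "x < y"
        using wordsE by blast
      obtain l r where lr: "l < r" "word_domain w = {l..r}"
        using W.domain[OF u(3)] by blast
      let ?E = "word_domain w"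
      have "Inf ?E = l" "Sup ?E = r" using lr by auto
      then have "word_domain u = D i \<or> i \<in> {i \<in> S. lo i < Inf ?E \<and> Inf ?E < hi i} \<union> {i \<in> S. lo i < Sup ?E \<and> Sup ?E < hi i}"
        using word_domain_Cons_cases[OF u(2) lr(2), of x y] xy u(1,2) by simp
      then have "word_domain u = D i \<or> word_domain u \<in> ?F ?E"
        using u(1) by auto
      then show "word_domain u \<in> D ` S \<union> (\<Union>E\<in>word_domain ` words n. ?F E)"
        using u by blast
    qed
    then show "finite (word_domain ` words (Suc n))"
      by (rule finite_subset) (intro finite_UnI finite_UN_I finite_imageI finite_domains W.finite_domains finite_straddling)
  next
    fix u assume "u \<in> words (Suc n)"
    then obtain i w x y where u: "u = i # w" "i \<in> S" "w \<in> words n" and xy: "x \<in> word_domain u" "y \<in> word_domain u" "x < y"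
      using wordsE by blast
    obtain \<sigma> where \<sigma>: "\<sigma> \<in> {1, -1}" "\<forall>x\<in>D i. \<forall>y\<in>D i. x \<le> y \<longrightarrow> \<sigma> * h i x \<le> \<sigma> * h i y"
      using h_monotone[OF u(2)] by blast
    obtain \<tau> where \<tau>: "\<tau> \<in> {1, -1}" "\<forall>x\<in>word_domain w. \<forall>y\<in>word_domain w. x \<le> y \<longrightarrow> \<tau> * word_map w x \<le> \<tau> * word_map w y"
      using W.h_monotone[OF u(3)] by blast
    obtain l r where lr: "a \<le> l" "r \<le> b" "D i = {l..r}" using domain[OF u(2)] by blast
    obtain l' r' where lr': "word_domain w = {l'..r'}" using W.domain[OF u(3)] by blast
    have "\<exists>p q. word_domain u = {p..q}"
      using monotone_vimage_interval[of l r "h i" \<sigma> l' r'] h_continuous[OF u(2)] \<sigma> unfolding lr(3) u(1) word_domain.simps lr' by blast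
    then obtain p q where pq: "word_domain u = {p..q}" by blast
    moreover have "word_domain u \<subseteq> {a..b}" using lr u(1) by auto
    ultimately show "\<exists>l r. a \<le> l \<and> l < r \<and> r \<le> b \<and> word_domain u = {l..r}"
      using xy by (intro exI[of _ p] exI[of _ q]) auto
    have mem: "x \<in> D i \<and> h i x \<in> word_domain w" if "x \<in> word_domain u" for x
      using that u(1) by simp
    have "\<sigma> * \<tau> * word_map u x \<le> \<sigma> * \<tau> * word_map u y"
      if "x \<in> word_domain u" "y \<in> word_domain u" "x \<le> y" for x y
    proof -
      have "\<sigma> * h i x \<le> \<sigma> * h i y"
        using \<sigma>(2) mem that by blast
      then consider "\<sigma> = 1" "h i x \<le> h i y" | "\<sigma> = -1" "h i y \<le> h i x"
        using \<sigma>(1) by auto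
      then show ?thesis
      proof cases
        case 1
        then show ?thesis using \<tau>(2) mem that u(1) by simp
      next
        case 2
        then show ?thesis using \<tau>(2) mem that u(1) by simp
      qed
    qed
    moreover have "\<sigma> * \<tau> \<in> {1, -1}" using \<sigma>(1) \<tau>(1) by auto
    ultimately show "\<exists>\<sigma>\<in>{1, -1}. \<forall>x\<in>word_domain u. \<forall>y\<in>word_domain u. x \<le> y \<longrightarrow> \<sigma> * word_map u x \<le> \<sigma> * word_map u y"
      by blast
    fix x assume x: "x \<in> word_domain u"
    have x': "x \<in> D i" "h i x \<in> word_domain w" using mem[OF x] by auto
    show "word_map u x \<in> {a..b}"
      using W.h_range[OF u(3) x'(2)] u(1) by simp
    show "0 < word_weight u x"
      using W.v_pos[OF u(3) x'(2)] v_pos[OF u(2) x'(1)] u(1) by simp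
    show "word_weight u x \<le> t ^ Suc n"
      using W.v_le[OF u(3) x'(2)] W.v_pos[OF u(3) x'(2)] v_le[OF u(2) x'(1)] t_nonneg u(1)
      by (auto intro!: mult_mono)
    fix y assume y: "y \<in> word_domain u"
    have y': "y \<in> D i" "h i y \<in> word_domain w" using mem[OF y] by auto
    show "\<bar>word_map u x - word_map u y\<bar> = \<bar>x - y\<bar> * word_weight u x * word_weight u y"
      using W.h_diff[OF u(3) x'(2) y'(2)] h_diff[OF u(2) x'(1) y'(1)] u(1) by simp
    let ?v = "v i" and ?w = "\<lambda>x. word_weight w (h i x)"
    have pos: "0 < ?v x" "0 < ?v y" "0 < ?w x" "?v y \<le> 1"
      using v_pos[OF u(2)] W.v_pos[OF u(3) x'(2)] v_le[OF u(2) y'(1)] x' y' assms by auto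
    \<comment> \<open>Product rule for differences: the first part contributes \<open>K\<close>, the
      second \<open>n * K\<close> after the distance of the images is rewritten by
      \<open>h_diff\<close> and factors \<open>?v y \<le> 1\<close> are dropped.\<close>
    have "\<bar>?v x * ?w x - ?v y * ?w y\<bar> = \<bar>(?v x - ?v y) * ?w x + ?v y * (?w x - ?w y)\<bar>"
      by (simp add: algebra_simps)
    also have "\<dots> \<le> \<bar>?v x - ?v y\<bar> * ?w x + ?v y * \<bar>?w x - ?w y\<bar>"
      using pos by (intro order_trans[OF abs_triangle_ineq]) (simp add: abs_mult)
    also have "\<dots> \<le> (K * \<bar>x - y\<bar> * ?v x) * ?w x + 1 * (n * K * \<bar>h i x - h i y\<bar> * ?w x)"
      using v_diff[OF u(2) x'(1) y'(1)] W.v_diff[OF u(3) x'(2) y'(2)] pos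
      by (intro add_mono mult_right_mono mult_mono) auto
    also have "\<dots> = (K * \<bar>x - y\<bar> * ?v x) * ?w x + ?v y * (n * K * \<bar>x - y\<bar> * ?v x * ?w x)"
      using h_diff[OF u(2) x'(1) y'(1)] by (simp add: algebra_simps)
    also have "\<dots> \<le> (K * \<bar>x - y\<bar> * ?v x) * ?w x + 1 * (n * K * \<bar>x - y\<bar> * ?v x * ?w x)"
      using pos K_nonneg by (intro add_mono order_refl mult_right_mono) auto
    also have "\<dots> = real (Suc n) * K * \<bar>x - y\<bar> * (?v x * ?w x)"
      by (simp add: algebra_simps)
    finally show "\<bar>word_weight u x - word_weight u y\<bar> \<le> real (Suc n) * K * \<bar>x - y\<bar> * word_weight u x"
      using u(1) by simp
  next
    fix u u' y z
    assume "u \<in> words (Suc n)" "u' \<in> words (Suc n)" and "y \<noteq> z"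
      and img: "{y, z} \<subseteq> word_map u ` word_domain u" "{y, z} \<subseteq> word_map u' ` word_domain u'"
    then obtain i w i' w' where u: "u = i # w" "i \<in> S" "w \<in> words n" "u' = i' # w'" "i' \<in> S" "w' \<in> words n"
      using wordsE by meson
    obtain y1 z1 where 1: "y1 \<in> D i" "z1 \<in> D i" "h i y1 \<in> word_domain w" "h i z1 \<in> word_domain w"
      "y = word_map w (h i y1)" "z = word_map w (h i z1)"
      using img(1) u(1) by auto
    obtain y2 z2 where 2: "y2 \<in> D i'" "z2 \<in> D i'" "h i' y2 \<in> word_domain w'" "h i' z2 \<in> word_domain w'"
      "y = word_map w' (h i' y2)" "z = word_map w' (h i' z2)"
      using img(2) u(4) by auto
    \<comment> \<open>The tails are identified first, as ranges of words lie in ranges of their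
      tails. Injectivity of the common tail then gives two distinct points shared by the ranges of
      \<open>h i\<close> and \<open>h i'\<close>.\<close>
    have "w = w'"
    proof (rule W.non_overlapping[OF u(3,6) \<open>y \<noteq> z\<close>])
      show "{y, z} \<subseteq> word_map w ` word_domain w" using 1(3-6) by blast
      show "{y, z} \<subseteq> word_map w' ` word_domain w'" using 2(3-6) by blast
    qed
    have "h i y1 = h i' y2" "h i z1 = h i' z2"
      using inj_onD[OF W.h_inj[OF u(3)]] 1 2 \<open>w = w'\<close> by auto
    moreover have "h i y1 \<noteq> h i z1" using 1 \<open>y \<noteq> z\<close> by auto
    ultimately have "i = i'"
    proof (intro non_overlapping[OF u(2,5), of "h i y1" "h i z1"])
      show "{h i y1, h i z1} \<subseteq> h i ` D i" using 1(1,2) by blast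
      show "{h i y1, h i z1} \<subseteq> h i' ` D i'"
        using 2(1,2) unfolding \<open>h i y1 = h i' y2\<close> \<open>h i z1 = h i' z2\<close> by blast
    qed
    with \<open>w = w'\<close> show "u = u'" using u by simp
  qed
qed

section \<open>Iterates of the branch sum as sums over words\<close>

definition word_sum :: "nat \<Rightarrow> (real \<Rightarrow> complex) \<Rightarrow> real \<Rightarrow> complex" where
  "word_sum n = branch_system.branch_sum (words n) word_domain word_map word_weight"

lemma negligible_degenerate_words:
  "negligible (\<Union>u\<in>(\<lambda>(i, w). i # w) ` (S \<times> words n) - words (Suc n). word_domain u)"
proof (rule negligible_countable_Union)
  have "countable (words m)" for m
  proof (induction m)
    case (Suc m)
    have "words (Suc m) \<subseteq> (\<lambda>(i, w). i # w) ` (S \<times> words m)" by auto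
    then show ?case
      by (rule countable_subset) (use countable_index Suc in auto)
  qed simp
  then show "countable (word_domain ` ((\<lambda>(i, w). i # w) ` (S \<times> words n) - words (Suc n)))"
    using countable_index by (intro countable_image countable_Diff countable_SIGMA)
next
  fix X assume "X \<in> word_domain ` ((\<lambda>(i, w). i # w) ` (S \<times> words n) - words (Suc n))"
  then obtain u where X: "X = word_domain u" and u: "u \<in> (\<lambda>(i, w). i # w) ` (S \<times> words n)" "u \<notin> words (Suc n)"
    by blast
  from u(1) obtain i w where iw: "u = i # w" "i \<in> S" "w \<in> words n"
    by auto
  have "\<not> (\<exists>x\<in>word_domain u. \<exists>y\<in>word_domain u. x < y)"
    using iw u(2) unfolding words.simps by blast
  then have "X \<subseteq> {SOME x. x \<in> X}"
    unfolding X by (metis linorder_neqE_linordered_idom singletonI someI subsetI)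
  then show "negligible X"
    by (rule negligible_subset[rotated]) simp
qed

text \<open>The iterated series is rearranged into one series over pairs, which is legitimate for
  bounded \<open>g\<close> because the product of the two Weierstrass majorants is summable.
  Equality fails at most on the domains of the omitted words.\<close>

lemma branch_sum_word_sum:
  assumes "t \<le> 1" and bound: "\<And>y. y \<in> {a..b} \<Longrightarrow> cmod (g y) \<le> B"
  shows "AE x in lebesgue_on {a..b}. branch_sum (word_sum n g) x = word_sum (Suc n) g x"
proof -
  interpret W: branch_system a b "t ^ n" "n * K" "words n" word_domain word_map word_weight
    by (rule words_branch_system[OF assms(1)])
  interpret W': branch_system a b "t ^ Suc n" "Suc n * K" "words (Suc n)" word_domain word_map word_weight
    by (rule words_branch_system[OF assms(1)])
  let ?A = "S \<times> words n" and ?cons = "\<lambda>(i, w). i # w"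
  let ?T = "\<lambda>u. W'.branch_term u g"
  have T: "?T (i # w) = branch_term i (W.branch_term w g)" for i w
    by (auto simp: fun_eq_iff branch_term_def W.branch_term_def indicator_def power_mult_distrib)
  obtain U where U: "U summable_on S" "\<forall>i\<in>S. 0 \<le> U i"
    "\<forall>i\<in>S. \<forall>x f B. (\<forall>y\<in>{a..b}. cmod (f y) \<le> B) \<longrightarrow> cmod (branch_term i f x) \<le> U i * B"
    using branch_term_bound by blast
  obtain V where V: "V summable_on words n" "\<forall>w\<in>words n. 0 \<le> V w"
    "\<forall>w\<in>words n. \<forall>x f B. (\<forall>y\<in>{a..b}. cmod (f y) \<le> B) \<longrightarrow> cmod (W.branch_term w f x) \<le> V w * B"
    using W.branch_term_bound by blast
  have B: "0 \<le> B"
    using order_trans[OF norm_ge_zero bound[of a]] a_less_b by auto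
  have product: "(\<lambda>(i, w). U i * (V w * B)) summable_on ?A"
  proof (rule summable_on_SigmaI)
    fix i
    show "((\<lambda>w. case (i, w) of (i, w) \<Rightarrow> U i * (V w * B)) has_sum U i * (infsum V (words n) * B)) (words n)"
      unfolding prod.case by (intro has_sum_cmult_right has_sum_cmult_left has_sum_infsum V(1))
  next
    show "(\<lambda>i. U i * (infsum V (words n) * B)) summable_on S"
      by (rule summable_on_cmult_left[OF U(1)])
  qed (use U(2) V(2) B in auto)
  have T_bound: "cmod (?T (i # w) x) \<le> U i * (V w * B)" if "i \<in> S" "w \<in> words n" for i w x
    unfolding T using U(3) V(3) that bound by blast
  have sum_A: "(\<lambda>p. ?T (?cons p) x) summable_on ?A" for x
    by (rule abs_summable_summable, rule summable_on_comparison_test[OF product]) (use T_bound in auto)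
  have "branch_sum (word_sum n g) x = word_sum (Suc n) g x"
    if x: "x \<notin> (\<Union>u\<in>?cons ` ?A - words (Suc n). word_domain u)" for x
  proof -
    have "branch_term i (word_sum n g) x = (\<Sum>\<^sub>\<infinity>w\<in>words n. ?T (?cons (i, w)) x)" for i
    proof -
      have "(\<Sum>\<^sub>\<infinity>w\<in>words n. ?T (?cons (i, w)) x)
          = (\<Sum>\<^sub>\<infinity>w\<in>words n. (of_real ((v i x)\<^sup>2) * indicator (D i) x) * W.branch_term w g (h i x))"
        by (simp add: T branch_term_def algebra_simps)
      also have "\<dots> = (of_real ((v i x)\<^sup>2) * indicator (D i) x) * (\<Sum>\<^sub>\<infinity>w\<in>words n. W.branch_term w g (h i x))"
        by (rule infsum_cmult_right')
      finally show ?thesis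
        by (simp add: branch_term_def word_sum_def W.branch_sum_def algebra_simps)
    qed
    then have "branch_sum (word_sum n g) x = (\<Sum>\<^sub>\<infinity>i\<in>S. \<Sum>\<^sub>\<infinity>w\<in>words n. ?T (?cons (i, w)) x)"
      by (simp add: branch_sum_def)
    also have "\<dots> = (\<Sum>\<^sub>\<infinity>p\<in>?A. ?T (?cons p) x)"
      by (rule infsum_Sigma_banach[OF sum_A])
    also have "\<dots> = (\<Sum>\<^sub>\<infinity>u\<in>?cons ` ?A. ?T u x)"
      by (subst infsum_reindex) (auto simp: inj_on_def o_def)
    also have "\<dots> = (\<Sum>\<^sub>\<infinity>u\<in>words (Suc n). ?T u x)"
    proof (rule infsum_cong_neutral)
      show "?T u x = 0" if "u \<in> ?cons ` ?A - words (Suc n)" for u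
        using x that by (auto simp: W'.branch_term_def indicator_def simp del: words.simps)
      have "words (Suc n) \<subseteq> ?cons ` ?A" by auto
      then show "?T u x = 0" if "u \<in> words (Suc n) - ?cons ` ?A" for u
        using that by blast
    qed simp
    finally show ?thesis
      unfolding word_sum_def[of "Suc n"] W'.branch_sum_def .
  qed
  then have "{x \<in> {a..b}. branch_sum (word_sum n g) x \<noteq> word_sum (Suc n) g x}
      \<subseteq> (\<Union>u\<in>?cons ` ?A - words (Suc n). word_domain u)"
    by blast
  then have "negligible {x \<in> {a..b}. branch_sum (word_sum n g) x \<noteq> word_sum (Suc n) g x}"
    by (rule negligible_subset[OF negligible_degenerate_words])
  then show ?thesis
    by (simp add: AE_lebesgue_on_iff_negligible)
qed

text \<open>The bounded representative \<open>g\<close> replaces \<open>f\<close>, whose series need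
  not converge everywhere; each further application of the operator preserves equality almost
  everywhere.\<close>

lemma funpow_branch_sum_AE:
  assumes "t \<le> 1" and bound: "\<And>y. y \<in> {a..b} \<Longrightarrow> cmod (g y) \<le> B"
    and fg: "AE x in lebesgue_on {a..b}. f x = g x"
  shows "AE x in lebesgue_on {a..b}. (branch_sum ^^ n) f x = word_sum n g x"
proof (induction n)
  case 0
  interpret W: branch_system a b "t ^ 0" "0 * K" "words 0" word_domain word_map word_weight
    using words_branch_system[OF assms(1), of 0] by simp
  have "word_sum 0 g x = g x" if "x \<in> {a..b}" for x
    using that unfolding word_sum_def W.branch_sum_def by (simp add: W.branch_term_def)
  then show ?case
    by (rule_tac AE_mp[OF fg]) (rule AE_I2, simp)
next
  case (Suc n)
  have "AE x in lebesgue_on {a..b}. branch_sum (word_sum n g) x = word_sum (Suc n) g x"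
    using assms(1) bound by (rule branch_sum_word_sum)
  with branch_sum_AE_cong[OF Suc] show ?case
    unfolding funpow.simps o_apply by eventually_elim (rule trans)
qed

lemma funpow_branch_sum_majorant:
  assumes "t \<le> 1"
  shows "\<exists>M\<ge>0. \<forall>\<phi> f g. majorizes a b \<phi> g \<longrightarrow> (AE x in lebesgue_on {a..b}. f x = g x) \<longrightarrow>
      (\<exists>G \<Psi>. (AE x in lebesgue_on {a..b}. (branch_sum ^^ n) f x = G x) \<and> majorizes a b \<Psi> G \<and>
        \<Psi> b - \<Psi> a \<le> 2 * t ^ (2 * n) * (\<phi> b - \<phi> a) + M * integral {a..b} (\<lambda>x. cmod (g x)) \<and>
        integral {a..b} (\<lambda>x. cmod (G x)) \<le> integral {a..b} (\<lambda>x. cmod (g x)))"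
proof -
  interpret W: branch_system a b "t ^ n" "n * K" "words n" word_domain word_map word_weight
    by (rule words_branch_system[OF assms])
  obtain M where M: "0 \<le> M"
    "\<And>\<phi> f. majorizes a b \<phi> f \<Longrightarrow> \<exists>\<Psi>. majorizes a b \<Psi> (W.branch_sum f) \<and>
      \<Psi> b - \<Psi> a \<le> 2 * (t ^ n)\<^sup>2 * (\<phi> b - \<phi> a) + M * integral {a..b} (\<lambda>x. cmod (f x))"
    using W.branch_sum_majorant by metis
  show ?thesis
  proof (intro exI[of _ M] conjI M(1) allI impI)
    fix \<phi> f g
    assume m: "majorizes a b \<phi> g" and fg: "AE x in lebesgue_on {a..b}. f x = g x"
    have "AE x in lebesgue_on {a..b}. (branch_sum ^^ n) f x = W.branch_sum g x"
      using funpow_branch_sum_AE[OF assms majorizes_bounded[OF m] fg, of n] by (simp add: word_sum_def)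
    moreover obtain \<Psi> where "majorizes a b \<Psi> (W.branch_sum g)"
      "\<Psi> b - \<Psi> a \<le> 2 * (t ^ n)\<^sup>2 * (\<phi> b - \<phi> a) + M * integral {a..b} (\<lambda>x. cmod (g x))"
      using M(2)[OF m] by blast
    moreover have "(t ^ n)\<^sup>2 = t ^ (2 * n)"
      by (simp add: power_mult[symmetric] mult.commute)
    ultimately show "\<exists>G \<Psi>. (AE x in lebesgue_on {a..b}. (branch_sum ^^ n) f x = G x) \<and> majorizes a b \<Psi> G \<and>
        \<Psi> b - \<Psi> a \<le> 2 * t ^ (2 * n) * (\<phi> b - \<phi> a) + M * integral {a..b} (\<lambda>x. cmod (g x)) \<and>
        integral {a..b} (\<lambda>x. cmod (G x)) \<le> integral {a..b} (\<lambda>x. cmod (g x))"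
      using W.branch_sum_integral_le[OF m] by (intro exI[of _ "W.branch_sum g"] exI[of _ \<Psi>]) simp
  qed
qed

end

section \<open>Iwasawa continued fraction maps\<close>

lemma inversions_abs: "\<iota> \<in> inversions \<Longrightarrow> \<bar>\<iota> x\<bar> = 1 / \<bar>x\<bar>"
  by (auto simp: inversions_def)

lemma inversions_branch:
  assumes \<iota>: "\<iota> \<in> inversions" and J: "0 \<notin> {l..r}"
  shows "\<exists>s\<in>{1, -1}. \<forall>x\<in>{l..r}. \<iota> x = s / x"
proof -
  consider "\<forall>x\<in>{l..r}. 0 < x" | "\<forall>x\<in>{l..r}. x < 0"
    using J by fastforce
  then show ?thesis
    using \<iota> by cases (auto simp: inversions_def)
qed

locale iwasawa =
  fixes a b \<gamma> :: real and T \<iota> :: "real \<Rightarrow> real" and P :: "real set set" and c :: "real set \<Rightarrow> real"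
  assumes iwasawa: "iwasawa_map a b T \<iota> P c"
    and \<gamma>_def: "\<gamma> = max \<bar>a\<bar> \<bar>b\<bar>" and proper: "\<gamma> < 1"
begin

abbreviation (input) "D \<equiv> branch_image \<iota> c"
abbreviation (input) "h \<equiv> inverse_branch \<iota> c"

lemma P_interval: "J \<in> P \<Longrightarrow> \<exists>l r. a \<le> l \<and> l < r \<and> r \<le> b \<and> J = {l..r}"
  using iwasawa unfolding iwasawa_map_def by (metis atLeastatMost_subset_iff less_imp_le)

lemma D_shape:
  assumes "J \<in> P"
  shows "D J = {a..b} \<or> (leftmost P J \<or> rightmost P J) \<and> (\<exists>d\<in>{a..b}. D J = {a..d} \<or> D J = {d..b})"
  using iwasawa assms unfolding iwasawa_map_def by blast

lemma D_subset: "J \<in> P \<Longrightarrow> D J \<subseteq> {a..b}"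
  by (drule D_shape, elim disjE conjE bexE) auto

lemma iota_inversion: "\<iota> \<in> inversions"
  using iwasawa by (simp add: iwasawa_map_def)

text \<open>Near 0 the inversion is unbounded, whereas the branch image lies in
  \<open>{a..b}\<close>. Nondegeneracy of \<open>J\<close> provides nonzero points of
  \<open>J\<close> arbitrarily close to 0.\<close>

lemma zero_notin:
  assumes J: "J \<in> P"
  shows "0 \<notin> J"
proof
  assume "0 \<in> J"
  obtain l r where lr: "l < r" "J = {l..r}" using P_interval[OF J] by blast
  define B where "B = \<bar>a\<bar> + \<bar>b\<bar> + \<bar>c J\<bar> + 1"
  have B: "0 < B" by (simp add: B_def)
  define z where "z = 1 / B"
  have z: "0 < z" using B by (simp add: z_def)
  have "l \<le> 0" "0 \<le> r" using \<open>0 \<in> J\<close> lr by auto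
  obtain x where x: "x \<in> J" "x \<noteq> 0" "\<bar>x\<bar> \<le> z"
  proof (cases "0 < r")
    case True
    then show ?thesis
      using that[of "min r z"] \<open>l \<le> 0\<close> z lr by (auto simp: min_def)
  next
    case False
    then show ?thesis
      using that[of "max l (- z)"] \<open>0 \<le> r\<close> z lr by (auto simp: max_def)
  qed
  have "B \<le> \<bar>\<iota> x\<bar>"
  proof -
    have "1 / z \<le> 1 / \<bar>x\<bar>" using x(2,3) z by (intro divide_left_mono) auto
    then show ?thesis by (simp add: inversions_abs[OF iota_inversion] z_def)
  qed
  moreover have "\<iota> x + c J \<in> {a..b}"
    using D_subset[OF J] x(1) by (auto simp: branch_image_def)
  ultimately show False by (auto simp: B_def)
qed

lemma h_formula:
  assumes J: "J \<in> P"
  shows "\<exists>s\<in>{1, -1}. (\<forall>x\<in>D J. h J x \<in> J \<and> x \<noteq> c J \<and> h J x = s / (x - c J)) \<and> (\<forall>y\<in>J. \<iota> y = s / y)"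
proof -
  obtain l r where lr: "J = {l..r}" using P_interval[OF J] by blast
  have "0 \<notin> {l..r}" using zero_notin[OF J] lr by simp
  from inversions_branch[OF iota_inversion this]
  obtain s where s: "s \<in> {1, -1}" "\<forall>y\<in>J. \<iota> y = s / y"
    unfolding lr by blast
  have "h J x \<in> J \<and> x \<noteq> c J \<and> h J x = s / (x - c J)" if x: "x \<in> D J" for x
  proof -
    have mem: "h J x \<in> J" and "\<iota> (h J x) + c J = x"
      using x unfolding inverse_branch_def branch_image_def
      by (auto intro: inv_into_into f_inv_into_f[where f = "\<lambda>x. \<iota> x + c J"])
    then have "s / h J x = x - c J" "h J x \<noteq> 0" "s \<noteq> 0"
      using s mem zero_notin[OF J] by force+
    then have "x - c J \<noteq> 0" "s = h J x * (x - c J)"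
      by (auto simp: field_simps)
    then show ?thesis using mem by auto
  qed
  then show ?thesis using s by blast
qed

lemma extreme_unique:
  assumes "J \<in> P" "K \<in> P"
  shows "leftmost P J \<Longrightarrow> leftmost P K \<Longrightarrow> J = K" "rightmost P J \<Longrightarrow> rightmost P K \<Longrightarrow> J = K"
proof -
  obtain l r l' r' where lr: "l < r" "J = {l..r}" "l' < r'" "K = {l'..r'}"
    using P_interval assms by meson
  have mem: "l \<in> J" "r \<in> J" "l' \<in> K" using lr by auto
  show "J = K" if "leftmost P J" "leftmost P K"
  proof (rule ccontr)
    assume "J \<noteq> K"
    then have "r \<le> l'" "l' \<le> l" using that mem assms unfolding leftmost_def by blast+
    with lr show False by simp
  qed
  show "J = K" if "rightmost P J" "rightmost P K"
  proof (rule ccontr)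
    assume "J \<noteq> K"
    then have "r \<le> l'" "l' \<le> l" using that mem assms unfolding rightmost_def by blast+
    with lr show False by simp
  qed
qed

text \<open>At most three images occur: \<open>{a..b}\<close> and those of the leftmost and the
  rightmost partition interval.\<close>

lemma finite_D: "finite (D ` P)"
proof -
  have sub: "finite X" if "\<And>J K. J \<in> X \<Longrightarrow> K \<in> X \<Longrightarrow> J = K" for X :: "real set set"
    using that by (metis finite.simps insertI1 subsetI subset_singletonD finite_subset singletonI)
  have "finite {J \<in> P. leftmost P J}" "finite {J \<in> P. rightmost P J}"
    using extreme_unique by (intro sub; blast)+
  moreover have "D ` P \<subseteq> insert {a..b} (D ` ({J \<in> P. leftmost P J} \<union> {J \<in> P. rightmost P J}))"
    using D_shape by blast
  ultimately show ?thesis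
    by (meson finite_UnI finite_imageI finite_insert finite_subset)
qed

text \<open>From \<open>h J x = s / (x - c J)\<close> one gets
  \<open>h J x - h J y = s * (y - x) * (h J x * h J y)\<close>, so the derivative has modulus
  \<open>(h J x)\<^sup>2\<close> and the weight is \<open>\<bar>h J x\<bar> \<le> \<gamma>\<close>.
  The same identity with \<open>\<bar>h J y\<bar> \<le> 1\<close> gives the distortion constant
  1.\<close>

sublocale branch_system a b \<gamma> 1 P D h "\<lambda>J x. \<bar>h J x\<bar>"
proof
  show "a < b" "countable P" using iwasawa by (auto simp: iwasawa_map_def)
  show "0 \<le> \<gamma>" by (simp add: \<gamma>_def)
  show "finite (D ` P)" by (rule finite_D)
next
  fix J assume J: "J \<in> P"
  obtain l r where lr: "a \<le> l" "l < r" "r \<le> b" "J = {l..r}" using P_interval[OF J] by blast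
  obtain s where s: "s \<in> {1, -1}"
    and h: "\<And>x. x \<in> D J \<Longrightarrow> h J x \<in> J \<and> x \<noteq> c J \<and> h J x = s / (x - c J)"
    and \<iota>: "\<And>y. y \<in> J \<Longrightarrow> \<iota> y = s / y"
    using h_formula[OF J] by blast
  obtain p q where pq: "a \<le> p" "q \<le> b" "D J = {p..q}"
    using D_shape[OF J] by (metis atLeastAtMost_iff order_refl)
  have "\<iota> l + c J \<noteq> \<iota> r + c J"
    using \<iota>[of l] \<iota>[of r] lr s zero_notin[OF J] by (auto simp: field_simps)
  moreover have "\<iota> l + c J \<in> D J" "\<iota> r + c J \<in> D J"
    using lr by (auto simp: branch_image_def)
  ultimately have "p < q" unfolding pq by auto
  then show "\<exists>l r. a \<le> l \<and> l < r \<and> r \<le> b \<and> D J = {l..r}"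
    using pq by blast
  have sign: "(\<forall>y\<in>J. 0 < y) \<or> (\<forall>y\<in>J. y < 0)"
    using zero_notin[OF J] unfolding lr(4) by fastforce
  have same_sign: "0 < h J x * h J y" if "x \<in> D J" "y \<in> D J" for x y
  proof -
    have "h J x \<in> J" "h J y \<in> J" using h that by blast+
    then show ?thesis using sign by (auto intro: mult_pos_pos mult_neg_neg)
  qed
  have subset: "J \<subseteq> {a..b}" using lr by auto
  have diff: "h J x - h J y = s * (y - x) * (h J x * h J y)" if "x \<in> D J" "y \<in> D J" for x y
    using h[OF that(1)] h[OF that(2)] s by (auto simp: field_simps)
  show "\<exists>\<sigma>\<in>{1, -1}. \<forall>x\<in>D J. \<forall>y\<in>D J. x \<le> y \<longrightarrow> \<sigma> * h J x \<le> \<sigma> * h J y"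
  proof (intro bexI[of _ "- s"] ballI impI)
    fix x y assume xy: "x \<in> D J" "y \<in> D J" "x \<le> y"
    have "s * (h J x - h J y) = (y - x) * (h J x * h J y)"
      using diff[OF xy(1,2)] s by auto
    moreover have "0 \<le> (y - x) * (h J x * h J y)"
      by (rule mult_nonneg_nonneg) (use same_sign[OF xy(1,2)] xy(3) in linarith)+
    ultimately show "- s * h J x \<le> - s * h J y"
      by (simp add: algebra_simps)
  qed (use s in auto)
  fix x assume x: "x \<in> D J"
  show "h J x \<in> {a..b}" using h[OF x] subset by blast
  then show "\<bar>h J x\<bar> \<le> \<gamma>" by (auto simp: \<gamma>_def)
  show "0 < \<bar>h J x\<bar>" using same_sign[OF x x] by auto
  fix y assume y: "y \<in> D J"
  show eq: "\<bar>h J x - h J y\<bar> = \<bar>x - y\<bar> * \<bar>h J x\<bar> * \<bar>h J y\<bar>"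
    using s by (auto simp: diff[OF x y] abs_mult)
  have "h J y \<in> {a..b}" using h[OF y] subset by blast
  then have "\<bar>h J y\<bar> \<le> 1"
    using proper by (auto simp: \<gamma>_def)
  then have "\<bar>x - y\<bar> * \<bar>h J x\<bar> * \<bar>h J y\<bar> \<le> \<bar>x - y\<bar> * \<bar>h J x\<bar> * 1"
    by (intro mult_left_mono) auto
  with eq show "\<bar>\<bar>h J x\<bar> - \<bar>h J y\<bar>\<bar> \<le> 1 * \<bar>x - y\<bar> * \<bar>h J x\<bar>"
    using abs_triangle_ineq3[of "h J x" "h J y"] by linarith
next
  fix J K y z
  assume J: "J \<in> P" and K: "K \<in> P" and "y \<noteq> z"
    and img: "{y, z} \<subseteq> h J ` D J" "{y, z} \<subseteq> h K ` D K"
  have "h L ` D L \<subseteq> L" if L: "L \<in> P" for L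
  proof -
    obtain s where "\<forall>x\<in>D L. h L x \<in> L \<and> x \<noteq> c L \<and> h L x = s / (x - c L)"
      using h_formula[OF L] by (elim bexE conjE)
    then show ?thesis by blast
  qed
  with J K img have mem: "{y, z} \<subseteq> J" "{y, z} \<subseteq> K" by blast+
  obtain l r l' r' where lr: "J = {l..r}" "K = {l'..r'}"
    using P_interval J K by meson
  \<comment> \<open>The midpoint turns two distinct common points into a common interior point,
    contradicting disjoint interiors unless \<open>J = K\<close>.\<close>
  have "(y + z) / 2 \<in> interior J \<inter> interior K"
    using mem \<open>y \<noteq> z\<close> unfolding lr by (auto simp: field_simps)
  then show "J = K"
    using iwasawa J K unfolding iwasawa_map_def by blast
qed simp

lemma transfer_eq_branch_sum: "transfer \<iota> P c = branch_sum"
proof (intro ext)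
  fix f x
  show "transfer \<iota> P c f x = branch_sum f x"
    unfolding transfer_def branch_sum_def Let_def
    by (intro infsum_cong) (auto simp: branch_term_def indicator_def abs_vector_derivative_h)
qed

end

section \<open>The Lasota-Yorke inequality\<close>

theorem mainTheorem4:
  fixes a b \<gamma> \<rho> :: real and T \<iota> :: "real \<Rightarrow> real"
    and P :: "real set set" and c :: "real set \<Rightarrow> real" and k :: nat
  assumes "iwasawa_map a b T \<iota> P c"
    and "\<gamma> = max \<bar>a\<bar> \<bar>b\<bar>" and "\<gamma> < 1"
    and "\<rho> = 2 * \<gamma> ^ (2 * k)" and "0 < \<rho>" and "\<rho> < 1"
  shows "\<exists>M\<^sub>0\<ge>0. \<forall>f\<in>BV a b.
    (transfer \<iota> P c ^^ k) f \<in> BV a b \<and>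
    ess_var a b ((transfer \<iota> P c ^^ k) f)
      \<le> ennreal \<rho> * ess_var a b f + ennreal M\<^sub>0 * L1_norm a b f \<and>
    BV_norm a b ((transfer \<iota> P c ^^ k) f)
      \<le> ennreal \<rho> * BV_norm a b f + ennreal (M\<^sub>0 + 1 - \<rho>) * L1_norm a b f"
proof -
  interpret iwasawa a b \<gamma> T \<iota> P c
    using assms by unfold_locales
  let ?H = "transfer \<iota> P c ^^ k"
  obtain M where M: "0 \<le> M"
    and maj: "\<forall>\<phi> f g. majorizes a b \<phi> g \<longrightarrow> (AE x in lebesgue_on {a..b}. f x = g x) \<longrightarrow>
      (\<exists>G \<Psi>. (AE x in lebesgue_on {a..b}. ?H f x = G x) \<and> majorizes a b \<Psi> G \<and>
        \<Psi> b - \<Psi> a \<le> \<rho> * (\<phi> b - \<phi> a) + M * integral {a..b} (\<lambda>x. cmod (g x)) \<and>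
        integral {a..b} (\<lambda>x. cmod (G x)) \<le> integral {a..b} (\<lambda>x. cmod (g x)))"
    using funpow_branch_sum_majorant[OF less_imp_le[OF proper], of k]
    unfolding transfer_eq_branch_sum assms(4) by (elim exE conjE)
  show ?thesis
  proof (intro exI[of _ M] conjI ballI M)
    fix f assume f: "f \<in> BV a b"
    \<comment> \<open>The estimate is proved for each representative \<open>g\<close> of finite
      variation; the infimum over \<open>g\<close> is taken afterwards.\<close>
    have step: "integrable (lebesgue_on {a..b}) (?H f) \<and> L1_norm a b f < \<infinity> \<and>
        L1_norm a b (?H f) \<le> L1_norm a b f \<and>
        ess_var a b (?H f) \<le> ennreal \<rho> * total_variation a b g + ennreal M * L1_norm a b f"
      if g: "AE x in lebesgue_on {a..b}. g x = f x" "total_variation a b g < \<infinity>" for g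
    proof -
      obtain \<phi> where \<phi>: "majorizes a b \<phi> g" "ennreal (\<phi> b - \<phi> a) \<le> total_variation a b g"
        using total_variation_majorant[OF less_imp_le[OF a_less_b] g(2)] by blast
      let ?I = "integral {a..b} (\<lambda>x. cmod (g x))"
      have fg: "AE x in lebesgue_on {a..b}. f x = g x"
        using g(1) by (simp add: eq_commute)
      obtain G \<Psi> where G: "AE x in lebesgue_on {a..b}. ?H f x = G x" "majorizes a b \<Psi> G"
        "\<Psi> b - \<Psi> a \<le> \<rho> * (\<phi> b - \<phi> a) + M * ?I" "integral {a..b} (\<lambda>x. cmod (G x)) \<le> ?I"
        using maj[rule_format, OF \<phi>(1) fg] by (elim exE conjE)
      have GH: "AE x in lebesgue_on {a..b}. G x = ?H f x"
        using G(1) by (simp add: eq_commute)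
      have L1: "L1_norm a b f = ennreal ?I"
        by (rule L1_norm_AE_eq[OF \<phi>(1) g(1)])
      have nonneg: "0 \<le> ?I"
        by (rule integral_nonneg[OF majorizes_norm_integrable_on[OF \<phi>(1)]]) simp
      have "ess_var a b (?H f) \<le> total_variation a b G"
        unfolding ess_var_def by (rule INF_lower) (use GH in simp)
      also have "\<dots> \<le> ennreal (\<rho> * (\<phi> b - \<phi> a) + M * ?I)"
        using total_variation_le_majorant[OF G(2)] a_less_b G(3) by (meson ennreal_leI less_imp_le order_trans)
      also have "\<dots> = ennreal \<rho> * ennreal (\<phi> b - \<phi> a) + ennreal M * ennreal ?I"
        using majorizesD(2)[OF \<phi>(1), of a b] a_less_b M nonneg \<open>0 < \<rho>\<close> by (simp add: ennreal_mult)
      also have "\<dots> \<le> ennreal \<rho> * total_variation a b g + ennreal M * L1_norm a b f"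
        unfolding L1 by (intro add_mono mult_left_mono \<phi>(2)) auto
      finally have "ess_var a b (?H f) \<le> ennreal \<rho> * total_variation a b g + ennreal M * L1_norm a b f" .
      moreover have "integrable (lebesgue_on {a..b}) (?H f)"
        by (rule integrable_lebesgue_on_AE_eq[OF majorizes_integrable[OF G(2)] GH])
      moreover have "L1_norm a b (?H f) \<le> L1_norm a b f"
        unfolding L1 L1_norm_AE_eq[OF G(2) GH] by (rule ennreal_leI[OF G(4)])
      ultimately show ?thesis using L1 by simp
    qed
    have fin: "ess_var a b f < \<infinity>" using f by (simp add: BV_def)
    then obtain g where g: "AE x in lebesgue_on {a..b}. g x = f x" "total_variation a b g < \<infinity>"
      unfolding ess_var_def INF_less_iff by blast
    show var: "ess_var a b (?H f) \<le> ennreal \<rho> * ess_var a b f + ennreal M * L1_norm a b f"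
      using step by (intro le_mult_ess_var_add \<open>0 < \<rho>\<close> fin) blast
    also have "\<dots> < \<infinity>"
      using fin step[OF g] by (simp add: ennreal_mult_less_top)
    finally show "?H f \<in> BV a b"
      using step[OF g] by (simp add: BV_def)
    have "BV_norm a b (?H f) \<le> L1_norm a b f + (ennreal \<rho> * ess_var a b f + ennreal M * L1_norm a b f)"
      unfolding BV_norm_def using step[OF g] var by (intro add_mono) auto
    also have "\<dots> = ennreal \<rho> * BV_norm a b f + ennreal (M + 1 - \<rho>) * L1_norm a b f"
    proof -
      \<comment> \<open>The coefficient 1 of \<open>L1_norm a b f\<close>, from contraction, is
        split: the part \<open>\<rho>\<close> completes \<open>\<rho>\<close> times the
        \<open>BV_norm\<close>, and \<open>1 - \<rho>\<close> joins \<open>M\<close>.\<close>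
      have one: "ennreal \<rho> + ennreal (1 - \<rho>) = 1"
        using assms(5,6) ennreal_plus[of \<rho> "1 - \<rho>"] by simp
      have plus: "ennreal (M + 1 - \<rho>) = ennreal M + ennreal (1 - \<rho>)"
        using assms(6) M ennreal_plus[of M "1 - \<rho>"] by (simp add: add_diff_eq)
      have "(r + s) * L + (r * E + m * L) = r * (L + E) + (m + s) * L" for r s m L E :: ennreal
        by (simp add: distrib_left distrib_right add_ac)
      from this[of "ennreal \<rho>" "ennreal (1 - \<rho>)"] show ?thesis
        unfolding BV_norm_def plus one mult_1 .
    qed
    finally show "BV_norm a b (?H f) \<le> ennreal \<rho> * BV_norm a b f + ennreal (M + 1 - \<rho>) * L1_norm a b f" .
  qed
qed

end
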